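(* Let $K$ be a field and let $B$ be a homogeneous simplicial affine semigroup, given as described in the context, with equivalence classes $\Gamma_1,\ldots,\Gamma_f$ on $B_A$. Let $t\in\{1,\ldots,f\}$ be such that $\Gamma_t\in\Gamma(B)$, that is, $\operatorname{reg}K[B]=\operatorname{reg} I_t+\deg h_t$. If $\#\Gamma_t\leq 2$, then $$\operatorname{reg} K[B]\leq \deg K[B]-\operatorname{codim} K[B].$$
   Context: $\mathbb N=\{0,1,2,\ldots\}$. Setting for $B$: let $d,\alpha,c\geq 1$ be integers and $M_{d,\alpha}=\{(u_1,\ldots,u_d)\in\mathbb N^d\mid \sum_{i=1}^d u_i=\alpha\}$. $B$ is the submonoid of $(\mathbb N^d,+)$ generated by $\{e_1,\ldots,e_d,a_1,\ldots,a_c\}\subseteq M_{d,\alpha}$, where $e_i=(0,\ldots,0,\alpha,0,\ldots,0)$ ($\alpha$ in position $i$), the listed $d+c$ generators being pairwise distinct, and where the coordinates $a_{i[j]}$ ($1\le i\le c$, $1\le j\le d$) of $a_1,\dots,a_c$ are relatively prime (the gcd of all of them is $1$). $K[B]$ is the subring of $K[t_1,\ldots,t_d]$ generated by the monomials $t^b=t_1^{b_1}\cdots t_d^{b_d}$, $b\in B$, graded by $\deg t^b=(\sum_i b_i)/\alpha$. Its Krull dimension is $d$. $\deg K[B]$ denotes its degree (multiplicity, i.e. $(d-1)!$ times the leading coefficient of its Hilbert polynomial), and $\operatorname{codim}K[B]=\dim_K K[B]_1-\dim K[B]=c$. Regularity: for a standard graded polynomial ring $R=K[x_1,\ldots,x_n]$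 with homogeneous maximal ideal $R_+$ and a finitely generated graded $R$-module $M$, $\operatorname{reg}M=\max\{i+a(H^i_{R_+}(M))\mid i\geq 0\}$, where $a(H)=\max\{r\mid H_r\neq 0\}$ and $a(0)=-\infty$. $\operatorname{reg}K[B]$ is the regularity of $K[B]$ as a graded module over $R=K[x_1,\ldots,x_{d+c}]$ via the surjection $x_i\mapsto t_i^{\alpha}$ ($1\le i\le d$), $x_{d+j}\mapsto t^{a_j}$ ($1\le j\le c$). Decomposition data: $A=\langle e_1,\ldots,e_d\rangle$ is the submonoid generated by $e_1,\dots,e_d$; $G(A)=\alpha\mathbb Z^d$ and $G(B)$ are the groups generated by $A$ and $B$. For $x\in G(B)$, $\deg x=(\sum_i x_{[i]})/\alpha$, where $x_{[i]}$ is the $i$-th coordinate. $B_A=\{x\in B\mid x-a\notin B\ \forall a\in A\setminus\{0\}\}$ (a finite set). On $G(B)$, $x\sim y$ means $x-y\in G(A)$; $\Gamma_1,\ldots,\Gamma_f$ are the equivalence classes of $\sim$ on $B_A$. For each $t$, $h_t=(\min_{m\in\Gamma_t}m_{[1]},\ldots,\min_{m\in\Gamma_t}m_{[d]})$. Then $x-h_t\in A$ for all $x\in\Gamma_t$. Let $T=K[y_1,\ldots,y_d]$ be standard graded and let $I_t$ be the monomial ideal of $T$ generated by the monomials $y^{(x-h_t)/\alpha}$, $x\in\Gamma_t$; $\operatorname{reg}I_t$ is its regularity as a graded $T$-module. It is known that $\operatorname{reg}K[B]=\max_{t}(\operatorname{reg}I_t+\deg h_t)$. $\Gamma(B)$ is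 the set of those classes $\Gamma_t$ with $\operatorname{reg}K[B]=\operatorname{reg}I_t+\deg h_t$. *)

theory Defs
  imports
    "HOL-Library.Poly_Mapping"
    "HOL-Library.Extended_Real"
    "HOL-Computational_Algebra.Group_Closure"
    "HOL-Computational_Algebra.Polynomial"
    "HOL-Algebra.Generated_Rings"
    "HOL-Algebra.Module"
    "HOL-Algebra.Product_Groups"
begin

section \<open>Polynomial rings\<close>

text \<open>
  Exponent vectors are finitely supported functions \<open>nat \<Rightarrow>\<^sub>0 nat\<close>; the elements of
  \<open>\<nat>\<^sup>d\<close> are those supported in \<open>{..<d}\<close>. Hence all indices start at 0: the variables of
  \<open>K[x\<^sub>1,\<dots>,x\<^sub>n]\<close> are \<open>mvar 0, \<dots>, mvar (n - 1)\<close>.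
\<close>

type_synonym expo = "nat \<Rightarrow>\<^sub>0 nat"
type_synonym 'k mpoly = "expo \<Rightarrow>\<^sub>0 'k"

definition nvecs :: "nat \<Rightarrow> expo set" where
  "nvecs n = {u. Poly_Mapping.keys u \<subseteq> {..<n}}"

definition total :: "expo \<Rightarrow> nat" where
  "total u = (\<Sum>i\<in>Poly_Mapping.keys u. Poly_Mapping.lookup u i)"

definition mmonom :: "expo \<Rightarrow> 'k::field mpoly" where
  "mmonom u = Poly_Mapping.single u 1"

definition mconst :: "'k::field \<Rightarrow> 'k mpoly" where
  "mconst k = Poly_Mapping.single 0 k"

definition mvar :: "nat \<Rightarrow> 'k::field mpoly" where
  "mvar i = mmonom (Poly_Mapping.single i 1)"

definition pring :: "nat \<Rightarrow> 'k::field mpoly ring" where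
  "pring n = \<lparr>carrier = {p. Poly_Mapping.keys p \<subseteq> nvecs n}, mult = (*), one = 1,
              zero = 0, add = (+)\<rparr>"

text \<open>The \<open>K\<close>-algebra homomorphism with \<open>x\<^sub>i \<mapsto> g i\<close>.\<close>

definition msubst :: "(nat \<Rightarrow> 'k mpoly) \<Rightarrow> 'k::field mpoly \<Rightarrow> 'k mpoly" where
  "msubst g p = (\<Sum>u\<in>Poly_Mapping.keys p. mconst (Poly_Mapping.lookup p u) *
                   (\<Prod>i\<in>Poly_Mapping.keys u. g i ^ Poly_Mapping.lookup u i))"

section \<open>Graded modules, local cohomology and regularity\<close>

text \<open>A module together with its homogeneous components.\<close>

record ('a, 'b) gmodule = "('a, 'b) module" +
  hcomp :: "int \<Rightarrow> 'b set"

text \<open>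
  The localization \<open>M\<^sub>f\<close>: \<open>mfrac f M m k\<close> is the fraction \<open>m / f\<^sup>k\<close>, i.e.\ the class of
  \<open>(m, k)\<close>. The parameter \<open>e\<close> of \<open>localization\<close> is the degree of the homogeneous element
  \<open>f\<close>. The ring fields \<open>mult\<close> and \<open>one\<close> of a module record play no role.
\<close>

definition loc_rel :: "'a::comm_ring_1 \<Rightarrow> ('a, 'b, 'z) module_scheme \<Rightarrow> (('b \<times> nat) \<times> ('b \<times> nat)) set"
  where "loc_rel f M = {((m, k), (m', k')). m \<in> carrier M \<and> m' \<in> carrier M \<and>
           (\<exists>l. f ^ l \<odot>\<^bsub>M\<^esub> (f ^ k' \<odot>\<^bsub>M\<^esub> m) = f ^ l \<odot>\<^bsub>M\<^esub> (f ^ k \<odot>\<^bsub>M\<^esub> m'))}"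

definition mfrac :: "'a::comm_ring_1 \<Rightarrow> ('a, 'b, 'z) module_scheme \<Rightarrow> 'b \<Rightarrow> nat \<Rightarrow> ('b \<times> nat) set"
  where "mfrac f M m k = loc_rel f M `` {(m, k)}"

definition localization ::
    "'a::comm_ring_1 \<Rightarrow> nat \<Rightarrow> ('a, 'b) gmodule \<Rightarrow> ('a, ('b \<times> nat) set) gmodule" where
  "localization f e M =
    \<lparr>carrier = (carrier M \<times> UNIV) // loc_rel f M,
     mult = undefined, one = undefined,
     zero = mfrac f M \<zero>\<^bsub>M\<^esub> 0,
     add = (\<lambda>X Y. \<Union>(m, k)\<in>X. \<Union>(m', k')\<in>Y.
              mfrac f M (f ^ k' \<odot>\<^bsub>M\<^esub> m \<oplus>\<^bsub>M\<^esub> f ^ k \<odot>\<^bsub>M\<^esub> m') (k + k')),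
     smult = (\<lambda>r X. \<Union>(m, k)\<in>X. mfrac f M (r \<odot>\<^bsub>M\<^esub> m) k),
     hcomp = (\<lambda>r. {mfrac f M m k | m k. m \<in> hcomp M (r + int (k * e))})\<rparr>"

text \<open>The natural map from \<open>M\<^sub>f\<close> to \<open>M\<close> localized at \<open>f * g\<close>.\<close>

definition loc_map :: "'a::comm_ring_1 \<Rightarrow> 'a \<Rightarrow> ('a, 'b) gmodule \<Rightarrow> ('b \<times> nat) set \<Rightarrow> ('b \<times> nat) set"
  where "loc_map f g M X = (\<Union>(m, k)\<in>X. mfrac (f * g) M (g ^ k \<odot>\<^bsub>M\<^esub> m) k)"

text \<open>
  Local cohomology with support in the homogeneous maximal ideal \<open>(x\<^sub>1,\<dots>,x\<^sub>n)\<close> of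
  \<open>K[x\<^sub>1,\<dots>,x\<^sub>n]\<close> is the cohomology of the \<^emph>\<open>Cech\<close> complex on the variables. That complex
  splits into its homogeneous strands; \<open>cech n M i r\<close> is the strand of degree \<open>r\<close> in
  cohomological degree \<open>i\<close>.
\<close>

definition vprod :: "nat set \<Rightarrow> 'k::field mpoly" where
  "vprod S = (\<Prod>i\<in>S. mvar i)"

definition mloc :: "('k::field mpoly, 'b) gmodule \<Rightarrow> nat set \<Rightarrow> ('k mpoly, ('b \<times> nat) set) gmodule"
  where "mloc M S = localization (vprod S) (card S) M"

definition isets :: "nat \<Rightarrow> nat \<Rightarrow> nat set set" where
  "isets n i = {S. S \<subseteq> {..<n} \<and> card S = i}"

definition cech :: "nat \<Rightarrow> ('k::field mpoly, 'b) gmodule \<Rightarrow> nat \<Rightarrow> int \<Rightarrow>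
    (nat set \<Rightarrow> ('b \<times> nat) set) monoid" where
  "cech n M i r = product_group (isets n i)
     (\<lambda>S. \<lparr>carrier = hcomp (mloc M S) r,
           monoid.mult = (\<lambda>x y. x \<oplus>\<^bsub>mloc M S\<^esub> y), one = \<zero>\<^bsub>mloc M S\<^esub>\<rparr>)"

definition cech_d :: "nat \<Rightarrow> ('k::field mpoly, 'b) gmodule \<Rightarrow> nat \<Rightarrow>
    (nat set \<Rightarrow> ('b \<times> nat) set) \<Rightarrow> nat set \<Rightarrow> ('b \<times> nat) set" where
  "cech_d n M i c = (\<lambda>S\<in>isets n (Suc i).
     \<Oplus>\<^bsub>mloc M S\<^esub>j\<in>S. (- 1) ^ card {s\<in>S. s < j} \<odot>\<^bsub>mloc M S\<^esub>
        loc_map (vprod (S - {j})) (mvar j) M (c (S - {j})))"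

definition coboundaries :: "nat \<Rightarrow> ('k::field mpoly, 'b) gmodule \<Rightarrow> nat \<Rightarrow> int \<Rightarrow>
    (nat set \<Rightarrow> ('b \<times> nat) set) set" where
  "coboundaries n M i r = (case i of 0 \<Rightarrow> {\<one>\<^bsub>cech n M 0 r\<^esub>}
                                   | Suc j \<Rightarrow> cech_d n M j ` carrier (cech n M j r))"

text \<open>\<open>local_cohomology n M i r\<close> is the degree \<open>r\<close> component of the \<open>i\<close>-th local cohomology.\<close>

definition local_cohomology :: "nat \<Rightarrow> ('k::field mpoly, 'b) gmodule \<Rightarrow> nat \<Rightarrow> int \<Rightarrow>
    (nat set \<Rightarrow> ('b \<times> nat) set) set monoid" where
  "local_cohomology n M i r =
     (cech n M i r)\<lparr>carrier := kernel (cech n M i r) (cech n M (Suc i) r) (cech_d n M i)\<rparr>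
       Mod coboundaries n M i r"

text \<open>
  Suprema in \<open>ereal\<close> stand for the maxima in the usual definitions, so that the convention
  \<open>a(0) = -\<infinity>\<close> is automatic; for finitely generated modules they are attained.
\<close>

definition a_invariant :: "(int \<Rightarrow> 'c monoid) \<Rightarrow> ereal" where
  "a_invariant H = (SUP r\<in>{r. carrier (H r) \<noteq> {\<one>\<^bsub>H r\<^esub>}}. ereal (of_int r))"

definition reg :: "nat \<Rightarrow> ('k::field mpoly, 'b) gmodule \<Rightarrow> ereal" where
  "reg n M = (SUP i. ereal (of_nat i) + a_invariant (local_cohomology n M i))"

section \<open>Dimension and degree\<close>

definition krull_dim :: "('a, 'z) ring_scheme \<Rightarrow> ereal" where
  "krull_dim R = (SUP n\<in>{n. \<exists>P. (\<forall>i\<le>n. primeideal (P i) R) \<and> (\<forall>i<n. P i \<subset> P (Suc i))}.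
                    ereal (of_nat n))"

definition hilbert_fun :: "('a, 'k::field mpoly) gmodule \<Rightarrow> int \<Rightarrow> nat" where
  "hilbert_fun M r = vector_space.dim (\<lambda>k p. mconst k * p) (hcomp M r)"

definition hilbert_poly :: "('a, 'k::field mpoly) gmodule \<Rightarrow> real poly" where
  "hilbert_poly M = (THE p. \<exists>r0::nat. \<forall>r\<ge>r0. poly p (of_nat r) = of_nat (hilbert_fun M (int r)))"

text \<open>The multiplicity of a graded ring of Krull dimension \<open>d\<close>.\<close>

definition mult_degree :: "nat \<Rightarrow> ('a, 'k::field mpoly) gmodule \<Rightarrow> real" where
  "mult_degree d M = fact (d - 1) * lead_coeff (hilbert_poly M)"

definition codim :: "('a, 'k::field mpoly) gmodule \<Rightarrow> ereal" where
  "codim M = ereal (of_nat (hilbert_fun M 1)) - krull_dim M"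

section \<open>Homogeneous simplicial affine semigroups\<close>

inductive_set submonoid_of :: "'a::comm_monoid_add set \<Rightarrow> 'a set" for S where
  zero: "0 \<in> submonoid_of S"
| incl: "s \<in> S \<Longrightarrow> s \<in> submonoid_of S"
| add: "s \<in> submonoid_of S \<Longrightarrow> t \<in> submonoid_of S \<Longrightarrow> s + t \<in> submonoid_of S"

text \<open>The given generators \<open>e\<^sub>1,\<dots>,e\<^sub>d,a\<^sub>1,\<dots>,a\<^sub>c\<close>, indexed by \<open>{..<d + c}\<close>.\<close>

definition gens :: "nat \<Rightarrow> nat \<Rightarrow> (nat \<Rightarrow> expo) \<Rightarrow> nat \<Rightarrow> expo" where
  "gens d \<alpha> a i = (if i < d then Poly_Mapping.single i \<alpha> else a (i - d))"

definition simplicial_data :: "nat \<Rightarrow> nat \<Rightarrow> nat \<Rightarrow> (nat \<Rightarrow> expo) \<Rightarrow> bool" where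
  "simplicial_data d \<alpha> c a \<longleftrightarrow> d \<ge> 1 \<and> \<alpha> \<ge> 1 \<and> c \<ge> 1 \<and>
     (\<forall>i<c. a i \<in> nvecs d \<and> total (a i) = \<alpha>) \<and>
     inj_on (gens d \<alpha> a) {..<d + c} \<and>
     Gcd {Poly_Mapping.lookup (a i) j | i j. i < c \<and> j < d} = 1"

definition semiA :: "nat \<Rightarrow> nat \<Rightarrow> expo set" where
  "semiA d \<alpha> = submonoid_of ((\<lambda>i. Poly_Mapping.single i \<alpha>) ` {..<d})"

definition semiB :: "nat \<Rightarrow> nat \<Rightarrow> nat \<Rightarrow> (nat \<Rightarrow> expo) \<Rightarrow> expo set" where
  "semiB d \<alpha> c a = submonoid_of (gens d \<alpha> a ` {..<d + c})"

definition vdeg :: "nat \<Rightarrow> expo \<Rightarrow> real" where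
  "vdeg \<alpha> x = of_nat (total x) / of_nat \<alpha>"

text \<open>
  \<open>K[B]\<close>, as a ring and as a graded module over \<open>R = K[x\<^sub>1,\<dots>,x\<^bsub>d+c\<^esub>]\<close>.
\<close>

definition KB :: "nat \<Rightarrow> nat \<Rightarrow> nat \<Rightarrow> (nat \<Rightarrow> expo) \<Rightarrow> ('k::field mpoly, 'k mpoly) gmodule" where
  "KB d \<alpha> c a = (let C = generate_ring (pring d) (range mconst \<union> mmonom ` semiB d \<alpha> c a) in
    \<lparr>carrier = C, mult = (*), one = 1, zero = 0, add = (+),
     smult = (\<lambda>p q. msubst (\<lambda>i. mmonom (gens d \<alpha> a i)) p * q),
     hcomp = (\<lambda>r. {q \<in> C. \<forall>b\<in>Poly_Mapping.keys q. vdeg \<alpha> b = of_int r})\<rparr>)"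

text \<open>
  Membership \<open>x - a \<notin> B\<close> is meant in \<open>\<int>\<^sup>d\<close>, whereas subtraction of exponent vectors is
  truncated.
\<close>

definition BA :: "nat \<Rightarrow> nat \<Rightarrow> nat \<Rightarrow> (nat \<Rightarrow> expo) \<Rightarrow> expo set" where
  "BA d \<alpha> c a = {x \<in> semiB d \<alpha> c a. \<forall>y\<in>semiA d \<alpha> - {0}. \<not> (\<exists>b\<in>semiB d \<alpha> c a. x = b + y)}"

definition zvec :: "expo \<Rightarrow> (nat \<Rightarrow>\<^sub>0 int)" where
  "zvec u = Poly_Mapping.map int u"

definition groupA :: "nat \<Rightarrow> nat \<Rightarrow> (nat \<Rightarrow>\<^sub>0 int) set" where
  "groupA d \<alpha> = group_closure (zvec ` semiA d \<alpha>)"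

definition eqv_classes :: "nat \<Rightarrow> nat \<Rightarrow> nat \<Rightarrow> (nat \<Rightarrow> expo) \<Rightarrow> expo set set" where
  "eqv_classes d \<alpha> c a = BA d \<alpha> c a //
     {(x, y). x \<in> BA d \<alpha> c a \<and> y \<in> BA d \<alpha> c a \<and> zvec x - zvec y \<in> groupA d \<alpha>}"

definition hvec :: "nat \<Rightarrow> expo set \<Rightarrow> expo" where
  "hvec d \<Gamma> = (\<Sum>i<d. Poly_Mapping.single i (Min ((\<lambda>m. Poly_Mapping.lookup m i) ` \<Gamma>)))"

text \<open>
  The exponent \<open>(x - h) / \<alpha>\<close>. For the classes above and \<open>h = hvec d \<Gamma>\<close> the subtraction is
  not truncating and the division is exact.
\<close>

definition quot_vec :: "nat \<Rightarrow> nat \<Rightarrow> expo \<Rightarrow> expo \<Rightarrow> expo" where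
  "quot_vec d \<alpha> x h = (\<Sum>i<d. Poly_Mapping.single i
      ((Poly_Mapping.lookup x i - Poly_Mapping.lookup h i) div \<alpha>))"

text \<open>The monomial ideal \<open>I\<^sub>t\<close> of \<open>T = K[y\<^sub>1,\<dots>,y\<^sub>d]\<close> as a graded \<open>T\<close>-module.\<close>

definition idealI :: "nat \<Rightarrow> nat \<Rightarrow> expo set \<Rightarrow> ('k::field mpoly, 'k mpoly) gmodule" where
  "idealI d \<alpha> \<Gamma> = (let J = genideal (pring d) ((\<lambda>x. mmonom (quot_vec d \<alpha> x (hvec d \<Gamma>))) ` \<Gamma>) in
    \<lparr>carrier = J, mult = (*), one = 1, zero = 0, add = (+), smult = (*),
     hcomp = (\<lambda>r. {q \<in> J. \<forall>u\<in>Poly_Mapping.keys q. int (total u) = r})\<rparr>)"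

text \<open>The set of classes attaining the regularity; the first argument fixes the field.\<close>

definition GammaB :: "'k::field itself \<Rightarrow> nat \<Rightarrow> nat \<Rightarrow> nat \<Rightarrow> (nat \<Rightarrow> expo) \<Rightarrow> expo set set" where
  "GammaB K d \<alpha> c a = {\<Gamma> \<in> eqv_classes d \<alpha> c a.
     reg (d + c) (KB d \<alpha> c a :: ('k mpoly, 'k mpoly) gmodule) =
     reg d (idealI d \<alpha> \<Gamma> :: ('k mpoly, 'k mpoly) gmodule) + ereal (vdeg \<alpha> (hvec d \<Gamma>))}"

end

theory Submission
  imports Defs
begin

text \<open>
  By the hypothesis on \<open>\<Gamma>\<close> it suffices to bound \<open>reg I\<^sub>\<Gamma> + deg h\<close> by \<open>f - c\<close>, where \<open>f\<close> is the number
  of classes: \<open>B\<close> is the disjoint union of the translated monomial ideals \<open>h\<^sub>t + \<alpha> I\<^sub>t\<close>, so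
  \<open>deg K[B] = f\<close>, and the kernels of the projections of \<open>K[B]\<close> to coordinate faces form a chain of
  \<open>d + 1\<close> primes, so \<open>codim K[B] \<le> c\<close>.

  If \<open>\<Gamma> = {m, n}\<close>, then \<open>I\<^sub>\<Gamma>\<close> is generated by two coprime monomials \<open>y\<^sup>u\<close>, \<open>y\<^sup>v\<close>, and the
  \<open>\<int>\<^sup>d\<close>-graded strands of its Cech complex show \<open>reg I\<^sub>\<Gamma> \<le> \<bar>u\<bar> + \<bar>v\<bar> - 1\<close>. This leaves
  \<open>deg m + deg n - deg h - 1 \<le> f - c\<close>, for which pairwise inequivalent elements of \<open>B\<^sub>A\<close> are exhibited:
  0, the \<open>a\<^sub>i\<close>, and the partial sums of decompositions of \<open>m\<close> and \<open>n\<close> into generators which start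
  with a common summand \<open>p\<close> of maximal degree; here \<open>deg p \<le> deg h\<close>. The case \<open>\<Gamma> = {m}\<close> is similar.
\<close>

section \<open>Exponent vectors\<close>

text \<open>The two bounds match because deg m = deg h + |u| and deg n = deg h + |v|, so |u| + |v| -
  1 + deg h = deg m + deg n - deg h - 1. The obstacle in the count is that a partial sum P of m may
  be congruent to a partial sum Q of n. In that case the remainder m - P is attached to Q: the
  element Q + (m - P) is congruent to m, and as the class contains only m and n, it lies above one
  of them. Beyond the common summand p, either alternative produces a common summand of larger
  degree, which is why p is taken maximal. This exchange is where the size of the class matters for
  the count. On the homological side, elements of localizations are equivalence classes of
  fractions. They are replaced by their coefficient functions on Laurent exponents w; the Cech
  differential then becomes, for each single w, a simplicial coboundary with scalar values, and
  vanishing follows from contracting a cone. The apex may change with w, so finiteness of supports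
  has to be kept under control.\<close>

abbreviation lookup where "lookup \<equiv> Poly_Mapping.lookup"
abbreviation keys where "keys \<equiv> Poly_Mapping.keys"
abbreviation single where "single \<equiv> Poly_Mapping.single"

lemma nvecs_iff: "x \<in> nvecs d \<longleftrightarrow> (\<forall>i\<ge>d. lookup x i = 0)"
proof -
  have "keys x \<subseteq> {..<d} \<longleftrightarrow> (\<forall>i. d \<le> i \<longrightarrow> i \<notin> keys x)"
    using not_le by blast
  then show ?thesis by (simp add: nvecs_def in_keys_iff)
qed

lemma total_eq_sum: "x \<in> nvecs d \<Longrightarrow> total x = (\<Sum>i<d. lookup x i)"
  unfolding total_def nvecs_def by (intro sum.mono_neutral_left) (auto simp: in_keys_iff)

lemma obtain_dim: "\<exists>d. x \<in> nvecs d \<and> y \<in> nvecs d"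
proof -
  have "finite (keys x \<union> keys y)" by simp
  then obtain d where "\<forall>i\<in>keys x \<union> keys y. i < d"
    by (meson finite_nat_set_iff_bounded)
  then show ?thesis by (auto simp: nvecs_def)
qed

lemma nvecs_add: "x \<in> nvecs d \<Longrightarrow> y \<in> nvecs d \<Longrightarrow> x + y \<in> nvecs d"
  by (auto simp: nvecs_iff lookup_add)

lemma nvecs_minus: "x \<in> nvecs d \<Longrightarrow> x - y \<in> nvecs d" for x :: expo
  by (auto simp: nvecs_iff lookup_minus)

lemma nvecs_zero: "0 \<in> nvecs d"
  by (auto simp: nvecs_iff)

lemma nvecs_single: "i < d \<Longrightarrow> single i k \<in> nvecs d"
  by (auto simp: nvecs_iff lookup_single when_def)

lemma total_add: "total (x + y) = total x + total y"
proof -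
  obtain d where "x \<in> nvecs d" "y \<in> nvecs d" using obtain_dim by blast
  then show ?thesis by (simp add: total_eq_sum[of _ d] nvecs_add lookup_add sum.distrib)
qed

lemma total_single [simp]: "total (single i k) = k"
  by (auto simp: total_def)

lemma total_zero [simp]: "total 0 = 0"
  by (simp add: total_def)

lemma total_eq_0_iff: "total x = 0 \<longleftrightarrow> x = 0"
  by (auto simp: total_def in_keys_iff intro!: poly_mapping_eqI)

lemma lookup_le_total: "lookup x i \<le> total x"
  by (cases "i \<in> keys x") (auto simp: total_def in_keys_iff member_le_sum)

lemma total_mono: "(\<And>i. lookup x i \<le> lookup y i) \<Longrightarrow> total x \<le> total y"
proof -
  assume a: "\<And>i. lookup x i \<le> lookup y i"
  obtain d where "x \<in> nvecs d" "y \<in> nvecs d" using obtain_dim by blast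
  then show ?thesis using a by (simp add: total_eq_sum sum_mono)
qed

lemma eq_single_if_lookup_eq_total:
  assumes "lookup x i = total x" shows "x = single i (total x)"
proof -
  have "lookup x j = 0" if "j \<noteq> i" for j
  proof (rule ccontr)
    assume j: "lookup x j \<noteq> 0"
    show False
    proof (cases "lookup x i = 0")
      case True then show False using assms total_eq_0_iff[of x] j by simp
    next
      case False
      then have "sum (lookup x) {i,j} \<le> total x"
        unfolding total_def using j by (intro sum_mono2) (auto simp: in_keys_iff)
      then show False using that j assms by simp
    qed
  qed
  then show ?thesis using assms by (intro poly_mapping_eqI) (auto simp: lookup_single when_def)
qed

definition vec :: "nat \<Rightarrow> (nat \<Rightarrow> nat) \<Rightarrow> expo" where
  "vec d f = (\<Sum>i<d. single i (f i))"

lemma lookup_vec [simp]: "lookup (vec d f) i = (if i < d then f i else 0)"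
  unfolding vec_def by (auto simp: lookup_sum lookup_single when_def)

lemma vec_in_nvecs [simp]: "vec d f \<in> nvecs d"
  by (simp add: nvecs_iff)

lemma total_vec [simp]: "total (vec d f) = (\<Sum>i<d. f i)"
  by (simp add: total_eq_sum[of _ d])

lemma submonoid_of_subset:
  assumes "S \<subseteq> M" "0 \<in> M" "\<And>x y. x \<in> M \<Longrightarrow> y \<in> M \<Longrightarrow> x + y \<in> M"
  shows "submonoid_of S \<subseteq> M"
proof
  fix x assume "x \<in> submonoid_of S"
  then show "x \<in> M" using assms by induction auto
qed

lemma submonoid_of_mono: "S \<subseteq> T \<Longrightarrow> submonoid_of S \<subseteq> submonoid_of T"
  by (rule submonoid_of_subset) (auto intro: submonoid_of.intros)

lemma submonoid_of_sum: "(\<And>i. i \<in> I \<Longrightarrow> f i \<in> submonoid_of S) \<Longrightarrow> sum f I \<in> submonoid_of S"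
  by (induction I rule: infinite_finite_induct) (auto intro: submonoid_of.intros)

lemma submonoid_of_last:
  assumes "x \<in> submonoid_of S"
  shows "x = 0 \<or> (\<exists>y\<in>submonoid_of S. \<exists>g\<in>S. x = y + g)"
  using assms
proof induction
  case (incl s)
  then show ?case by (metis add.left_neutral submonoid_of.zero)
next
  case (add s t)
  then show ?case by (metis add.assoc add_0_right submonoid_of.add)
qed auto

section \<open>Congruence modulo G(A) and the order induced by A\<close>

lemma semiA_iff:
  "x \<in> semiA d \<alpha> \<longleftrightarrow> x \<in> nvecs d \<and> (\<forall>i. \<alpha> dvd lookup x i)"
proof
  assume "x \<in> semiA d \<alpha>"
  moreover have "semiA d \<alpha> \<subseteq> {x \<in> nvecs d. \<forall>i. \<alpha> dvd lookup x i}"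
    unfolding semiA_def
    by (rule submonoid_of_subset) (auto simp: nvecs_iff lookup_single when_def lookup_add)
  ultimately show "x \<in> nvecs d \<and> (\<forall>i. \<alpha> dvd lookup x i)" by auto
next
  assume x: "x \<in> nvecs d \<and> (\<forall>i. \<alpha> dvd lookup x i)"
  have m: "single i (\<alpha> * k) \<in> semiA d \<alpha>" if "i < d" for i k
  proof -
    have "(\<Sum>j<k. single i \<alpha>) \<in> semiA d \<alpha>"
      unfolding semiA_def by (rule submonoid_of_sum) (use that in \<open>auto intro: submonoid_of.incl\<close>)
    moreover have "(\<Sum>j<k. single i \<alpha>) = single i (\<alpha> * k)"
      by (rule poly_mapping_eqI) (simp only: lookup_sum, simp add: lookup_single when_def)
    ultimately show ?thesis by simp
  qed
  have "x = (\<Sum>i<d. single i (\<alpha> * (lookup x i div \<alpha>)))"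
    using x by (intro poly_mapping_eqI) (auto simp: lookup_sum lookup_single when_def nvecs_iff)
  moreover have "\<dots> \<in> semiA d \<alpha>"
    unfolding semiA_def by (rule submonoid_of_sum) (use m in \<open>simp add: semiA_def\<close>)
  ultimately show "x \<in> semiA d \<alpha>" by simp
qed

text \<open>The relation written x ~ y in the setting, expressed by residues so that no negative
  vectors occur; \<open>zvec_diff_in_groupA_iff\<close> gives the link with G(A).\<close>

definition eqmod :: "nat \<Rightarrow> expo \<Rightarrow> expo \<Rightarrow> bool" where
  "eqmod \<alpha> x y \<longleftrightarrow> (\<forall>i. lookup x i mod \<alpha> = lookup y i mod \<alpha>)"

text \<open>For vectors in \<open>nvecs d\<close> this says that y - x lies in A, without
  subtracting (\<open>leA_iff\<close>).\<close>

definition leA :: "nat \<Rightarrow> expo \<Rightarrow> expo \<Rightarrow> bool" where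
  "leA \<alpha> x y \<longleftrightarrow> (\<forall>i. lookup x i \<le> lookup y i) \<and> eqmod \<alpha> x y"

lemma leA_iff:
  assumes "x \<in> nvecs d" "y \<in> nvecs d"
  shows "leA \<alpha> x y \<longleftrightarrow> (\<exists>z\<in>semiA d \<alpha>. y = x + z)"
proof
  assume l: "leA \<alpha> x y"
  have "y = x + (y - x)"
    using l by (intro poly_mapping_eqI) (simp add: leA_def lookup_add lookup_minus)
  moreover have "y - x \<in> semiA d \<alpha>"
    using l assms by (simp add: semiA_iff leA_def eqmod_def nvecs_minus lookup_minus mod_eq_dvd_iff_nat[symmetric])
  ultimately show "\<exists>z\<in>semiA d \<alpha>. y = x + z" by blast
next
  assume "\<exists>z\<in>semiA d \<alpha>. y = x + z"
  then obtain z where z: "y = x + z" "\<And>i. \<alpha> dvd lookup z i" by (auto simp: semiA_iff)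
  then have "(lookup x i + lookup z i) mod \<alpha> = lookup x i mod \<alpha>" for i
    by (metis add.right_neutral dvd_imp_mod_0 mod_add_right_eq)
  then show "leA \<alpha> x y" using z by (simp add: leA_def eqmod_def lookup_add)
qed

lemma eqmod_refl [simp]: "eqmod \<alpha> x x" by (simp add: eqmod_def)
lemma eqmod_sym: "eqmod \<alpha> x y \<Longrightarrow> eqmod \<alpha> y x" by (simp add: eqmod_def)
lemma eqmod_trans: "eqmod \<alpha> x y \<Longrightarrow> eqmod \<alpha> y z \<Longrightarrow> eqmod \<alpha> x z" by (simp add: eqmod_def)
lemma eqmod_add: "eqmod \<alpha> x y \<Longrightarrow> eqmod \<alpha> (x + z) (y + z)"
  by (auto simp: eqmod_def lookup_add intro: mod_add_cong)
lemma leA_imp_eqmod: "leA \<alpha> x y \<Longrightarrow> eqmod \<alpha> x y" by (simp add: leA_def)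
lemma leA_refl [simp]: "leA \<alpha> x x" by (simp add: leA_def)
lemma leA_trans: "leA \<alpha> x y \<Longrightarrow> leA \<alpha> y z \<Longrightarrow> leA \<alpha> x z"
  unfolding leA_def using eqmod_trans order_trans by metis
lemma leA_add_left:
  assumes "leA \<alpha> (z + x) (z + y)" shows "leA \<alpha> x y"
proof -
  have "lookup x i mod \<alpha> = lookup y i mod \<alpha>" for i
  proof -
    have "(lookup z i + lookup x i) mod \<alpha> = (lookup z i + lookup y i) mod \<alpha>"
      using assms unfolding leA_def eqmod_def lookup_add by blast
    then have "(int (lookup z i) + int (lookup x i)) mod int \<alpha> = (int (lookup z i) + int (lookup y i)) mod int \<alpha>"
      by (metis of_nat_add zmod_int)
    then have "int (lookup x i) mod int \<alpha> = int (lookup y i) mod int \<alpha>"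
      by (simp add: mod_eq_dvd_iff)
    then show ?thesis by (metis of_nat_eq_iff zmod_int)
  qed
  moreover have "lookup x i \<le> lookup y i" for i
    using assms unfolding leA_def lookup_add by (meson add_le_cancel_left)
  ultimately show ?thesis by (simp add: leA_def eqmod_def)
qed

lemma zvec_add: "zvec (x + y) = zvec x + zvec y"
  by (rule poly_mapping_eqI) (simp add: zvec_def lookup_add map.rep_eq when_def)

lemma lookup_zvec [simp]: "lookup (zvec x) i = int (lookup x i)"
  by (simp add: zvec_def map.rep_eq when_def)

lemma zvec_diff_in_groupA_iff:
  assumes "x \<in> nvecs d" "y \<in> nvecs d"
  shows "zvec x - zvec y \<in> groupA d \<alpha> \<longleftrightarrow> eqmod \<alpha> x y"
proof
  have z: "int \<alpha> dvd lookup z i" if "z \<in> groupA d \<alpha>" for z i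
    using that unfolding groupA_def
    by induction (auto simp: semiA_iff lookup_minus)
  assume "zvec x - zvec y \<in> groupA d \<alpha>"
  then have "int \<alpha> dvd int (lookup x i) - int (lookup y i)" for i
    using z[of "zvec x - zvec y" i] by (simp add: lookup_minus)
  then have "int (lookup x i mod \<alpha>) = int (lookup y i mod \<alpha>)" for i
    by (simp add: zmod_int mod_eq_dvd_iff)
  then show "eqmod \<alpha> x y"
    by (simp add: eqmod_def)
next
  assume e: "eqmod \<alpha> x y"
  \<comment> \<open>The join z lies above both vectors, so that x - y = (z - y) - (z - x) is a
    difference of two elements of A.\<close>
  define z where "z = vec d (\<lambda>i. max (lookup x i) (lookup y i))"
  have z: "z \<in> nvecs d" by (simp add: z_def)
  have "leA \<alpha> x z" "leA \<alpha> y z"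
    using e assms by (auto simp: leA_def eqmod_def z_def max_def nvecs_iff)
  then obtain p q where p: "p \<in> semiA d \<alpha>" "z = x + p" and q: "q \<in> semiA d \<alpha>" "z = y + q"
    using leA_iff z assms by metis
  then have "zvec x + zvec p = zvec y + zvec q" by (metis zvec_add)
  then have "zvec x - zvec y = zvec q - zvec p" by (simp add: algebra_simps)
  also have "\<dots> \<in> groupA d \<alpha>"
    unfolding groupA_def using p q by (intro group_closure.diff group_closure.base) auto
  finally show "zvec x - zvec y \<in> groupA d \<alpha>" .
qed

section \<open>Counting equivalence classes\<close>

locale simplicial_semigroup =
  fixes d \<alpha> c :: nat and a :: "nat \<Rightarrow> expo"
  assumes data: "simplicial_data d \<alpha> c a"
begin

abbreviation A where "A \<equiv> semiA d \<alpha>"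
abbreviation B where "B \<equiv> semiB d \<alpha> c a"
abbreviation B\<^sub>A where "B\<^sub>A \<equiv> BA d \<alpha> c a"

text \<open>The degree of x as a natural number; the division is exact on B.\<close>

definition rank :: "expo \<Rightarrow> nat" where "rank x = total x div \<alpha>"

lemma d_pos: "d \<ge> 1" and \<alpha>_pos: "\<alpha> \<ge> 1" and c_pos: "c \<ge> 1"
  and a_nvecs: "i < c \<Longrightarrow> a i \<in> nvecs d" and total_a: "i < c \<Longrightarrow> total (a i) = \<alpha>"
  and inj_gens: "inj_on (gens d \<alpha> a) {..<d + c}"
  using data by (auto simp: simplicial_data_def)

lemma gens_nvecs: "i < d + c \<Longrightarrow> gens d \<alpha> a i \<in> nvecs d"
  by (auto simp: gens_def nvecs_single a_nvecs)

lemma total_gens: "i < d + c \<Longrightarrow> total (gens d \<alpha> a i) = \<alpha>"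
  by (auto simp: gens_def total_a)

lemma gens_in_B: "i < d + c \<Longrightarrow> gens d \<alpha> a i \<in> B"
  unfolding semiB_def by (rule submonoid_of.incl) auto

lemma a_in_B: "i < c \<Longrightarrow> a i \<in> B"
  using gens_in_B[of "d + i"] by (simp add: gens_def)

lemma A_subset_B: "A \<subseteq> B"
  unfolding semiA_def semiB_def by (rule submonoid_of_mono) (force simp: gens_def)

lemma B_props: "x \<in> B \<Longrightarrow> x \<in> nvecs d \<and> \<alpha> dvd total x"
proof -
  have "B \<subseteq> {x \<in> nvecs d. \<alpha> dvd total x}"
    unfolding semiB_def
    by (rule submonoid_of_subset) (auto simp: nvecs_zero nvecs_add total_add gens_nvecs total_gens)
  then show "x \<in> B \<Longrightarrow> x \<in> nvecs d \<and> \<alpha> dvd total x" by auto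
qed

lemma B_nvecs: "x \<in> B \<Longrightarrow> x \<in> nvecs d"
  using B_props by blast

lemma A_nvecs: "x \<in> A \<Longrightarrow> x \<in> nvecs d"
  using A_subset_B B_nvecs by blast

lemma total_B: "x \<in> B \<Longrightarrow> total x = \<alpha> * rank x"
  using B_props by (simp add: rank_def)

lemma rank_add: "x \<in> B \<Longrightarrow> y \<in> B \<Longrightarrow> rank (x + y) = rank x + rank y"
  using B_props \<alpha>_pos by (simp add: rank_def total_add div_plus_div_distrib_dvd_left)

lemma rank_gens: "i < d + c \<Longrightarrow> rank (gens d \<alpha> a i) = 1"
  using \<alpha>_pos by (simp add: rank_def total_gens)

lemma rank_a: "i < c \<Longrightarrow> rank (a i) = 1"
  using \<alpha>_pos by (simp add: rank_def total_a)

lemma rank_zero [simp]: "rank 0 = 0"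
  by (simp add: rank_def)

lemma rank_eq_0: "x \<in> B \<Longrightarrow> rank x = 0 \<Longrightarrow> x = 0"
  using total_B[of x] by (simp add: total_eq_0_iff)

lemma B_zero: "0 \<in> B"
  by (simp add: semiB_def submonoid_of.zero)

lemma B_add: "x \<in> B \<Longrightarrow> y \<in> B \<Longrightarrow> x + y \<in> B"
  by (simp add: semiB_def submonoid_of.add)

lemma leA_A: "x \<in> nvecs d \<Longrightarrow> y \<in> nvecs d \<Longrightarrow> leA \<alpha> x y \<Longrightarrow> \<exists>z\<in>A. y = x + z"
  using leA_iff by blast

lemma leA_B: "x \<in> B \<Longrightarrow> z \<in> A \<Longrightarrow> leA \<alpha> x (x + z)"
  using leA_iff[of x d "x + z" \<alpha>] B_nvecs[of x] A_nvecs[of z] nvecs_add[of x d z] by auto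

lemma BA_iff: "x \<in> B\<^sub>A \<longleftrightarrow> x \<in> B \<and> (\<forall>y\<in>B. leA \<alpha> y x \<longrightarrow> y = x)"
proof
  assume x: "x \<in> B\<^sub>A"
  have "y = x" if y: "y \<in> B" "leA \<alpha> y x" for y
  proof -
    obtain z where z: "z \<in> A" "x = y + z"
      using leA_A[of y x] x y B_nvecs[of y] B_nvecs[of x] unfolding BA_def by blast
    then have "z = 0" using x y(1) unfolding BA_def by blast
    then show ?thesis using z by simp
  qed
  then show "x \<in> B \<and> (\<forall>y\<in>B. leA \<alpha> y x \<longrightarrow> y = x)" using x by (auto simp: BA_def)
next
  assume r: "x \<in> B \<and> (\<forall>y\<in>B. leA \<alpha> y x \<longrightarrow> y = x)"
  have False if "y \<in> A - {0}" "b \<in> B" "x = b + y" for y b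
    using r leA_B[of b y] that by auto
  then show "x \<in> B\<^sub>A" using r unfolding BA_def by blast
qed

lemma BA_in_B: "x \<in> B\<^sub>A \<Longrightarrow> x \<in> B"
  by (simp add: BA_iff)

lemma BA_minimal: "x \<in> B\<^sub>A \<Longrightarrow> y \<in> B \<Longrightarrow> leA \<alpha> y x \<Longrightarrow> y = x"
  by (simp add: BA_iff)

text \<open>An element of B strictly below x would, after adding y, lie strictly below x + y. Hence
  all partial sums of a decomposition of an element of \<open>B\<^sub>A\<close> stay in
  \<open>B\<^sub>A\<close>.\<close>

lemma BA_summand: "x + y \<in> B\<^sub>A \<Longrightarrow> x \<in> B \<Longrightarrow> y \<in> B \<Longrightarrow> x \<in> B\<^sub>A"
proof (unfold BA_iff[of x], safe)
  fix z assume *: "x + y \<in> B\<^sub>A" "x \<in> B" "y \<in> B" "z \<in> B" "leA \<alpha> z x"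
  then have "leA \<alpha> (z + y) (x + y)"
    by (auto simp: leA_def lookup_add eqmod_add)
  then have "z + y = x + y" using * BA_minimal B_add by blast
  then show "z = x" by simp
qed

lemma BA_below: "x \<in> B \<Longrightarrow> \<exists>m\<in>B\<^sub>A. leA \<alpha> m x"
proof (induction "total x" arbitrary: x rule: less_induct)
  case less
  show ?case
  proof (cases "x \<in> B\<^sub>A")
    case False
    then obtain y where y: "y \<in> B" "leA \<alpha> y x" "y \<noteq> x" using less.prems BA_iff by blast
    then obtain z where z: "z \<in> A" "x = y + z" using leA_A B_nvecs less.prems by blast
    then have "total y < total x"
      using y total_eq_0_iff[of z] by (auto simp: total_add)
    then obtain m where "m \<in> B\<^sub>A" "leA \<alpha> m y" using less.hyps y by blast
    then show ?thesis using y leA_trans by blast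
  qed (auto intro: leA_refl)
qed

lemma zero_in_BA: "0 \<in> B\<^sub>A"
  unfolding BA_iff using B_zero by (auto simp: leA_def intro!: poly_mapping_eqI)

lemma eqmod_zero_BA: "x \<in> B\<^sub>A \<Longrightarrow> eqmod \<alpha> x 0 \<Longrightarrow> x = 0"
  using BA_minimal[of x 0] B_zero by (auto simp: leA_def eqmod_sym)

text \<open>A coordinate of size \<alpha> would exhaust the total and turn the generator into some
  e_j, contrary to the distinctness of the generators.\<close>

lemma lookup_a_less: "i < c \<Longrightarrow> lookup (a i) j < \<alpha>"
proof (rule ccontr)
  assume i: "i < c" and "\<not> lookup (a i) j < \<alpha>"
  then have l: "lookup (a i) j = total (a i)" using lookup_le_total[of "a i" j] total_a by simp
  then have e: "a i = single j \<alpha>" using eq_single_if_lookup_eq_total[of "a i" j] i total_a by simp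
  then have "j < d" using a_nvecs[OF i] \<alpha>_pos by (auto simp: nvecs_def)
  then have "gens d \<alpha> a j = gens d \<alpha> a (d + i)" by (simp add: gens_def e)
  then show False using inj_onD[OF inj_gens, of j "d + i"] \<open>j < d\<close> i by simp
qed

lemma inj_a: "inj_on a {..<c}"
proof (rule inj_onI)
  fix i j assume "i \<in> {..<c}" "j \<in> {..<c}" "a i = a j"
  then show "i = j" using inj_onD[OF inj_gens, of "d + i" "d + j"] by (simp add: gens_def)
qed

text \<open>Coordinates below \<alpha> are themselves residues, so \<open>a i\<close> is the least
  vector of its congruence class. Consequently it is alone in its class on
  \<open>B\<^sub>A\<close>.\<close>

lemma eqmod_a_imp_leA:
  assumes "i < c" "eqmod \<alpha> (a i) x" shows "leA \<alpha> (a i) x"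
proof -
  have "lookup (a i) j = lookup x j mod \<alpha>" for j
    using assms lookup_a_less[of i j] by (simp add: eqmod_def) (metis mod_less)
  then show ?thesis using assms(2) by (simp add: leA_def)
qed

lemma eqmod_a_BA: "i < c \<Longrightarrow> x \<in> B\<^sub>A \<Longrightarrow> eqmod \<alpha> (a i) x \<Longrightarrow> x = a i"
  using eqmod_a_imp_leA BA_minimal a_in_B by metis

lemma a_in_BA: assumes "i < c" shows "a i \<in> B\<^sub>A"
proof -
  obtain m where m: "m \<in> B\<^sub>A" "leA \<alpha> m (a i)" using BA_below a_in_B assms by blast
  then show ?thesis using eqmod_a_BA[OF assms m(1)] by (auto simp: leA_def intro: eqmod_sym)
qed

lemma a_nonzero: "i < c \<Longrightarrow> a i \<noteq> 0"
  using rank_a by force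

text \<open>\<open>P\<close> lists the partial sums of a decomposition of \<open>x\<close> into generators.\<close>

definition chain :: "(nat \<Rightarrow> expo) \<Rightarrow> expo \<Rightarrow> bool" where
  "chain P x \<longleftrightarrow> P (rank x) = x \<and>
     (\<forall>j\<le>rank x. P j \<in> B \<and> rank (P j) = j \<and> (\<forall>i\<le>j. \<exists>b\<in>B. P j = P i + b))"

lemma chainD:
  assumes "chain P x" "j \<le> rank x"
  shows "P j \<in> B" "rank (P j) = j" "i \<le> j \<Longrightarrow> \<exists>b\<in>B. P j = P i + b" "\<exists>b\<in>B. x = P j + b"
  using assms unfolding chain_def by auto

lemma ex_chain: "x \<in> B \<Longrightarrow> \<exists>P. chain P x"
proof (induction "rank x" arbitrary: x)
  case 0
  then show ?case using B_zero rank_eq_0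
    by (intro exI[of _ "\<lambda>_. 0"]) (auto simp: chain_def)
next
  case (Suc k)
  then obtain y i where y: "y \<in> B" "i < d + c" "x = y + gens d \<alpha> a i"
    using submonoid_of_last[of x "gens d \<alpha> a ` {..<d + c}"] by (force simp: semiB_def)
  have k: "rank y = k" using Suc(2) y rank_add gens_in_B rank_gens by simp
  then obtain P where P: "chain P y" using Suc y by metis
  have "chain (P(Suc k := x)) x"
    unfolding chain_def
  proof (intro conjI allI impI)
    fix j i' assume ij: "j \<le> rank x" "i' \<le> j"
    show "\<exists>b\<in>B. (P(Suc k := x)) j = (P(Suc k := x)) i' + b"
    proof (cases "j = Suc k")
      case True
      show ?thesis
      proof (cases "i' = Suc k")
        case True
        then show ?thesis using \<open>j = Suc k\<close> B_zero by force
      next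
        case False
        then have "i' \<le> k" using True ij by simp
        then obtain b where "b \<in> B" "y = P i' + b" using chainD(4)[OF P] k by blast
        then show ?thesis using False True y
          by (auto simp: add.assoc intro!: bexI[of _ "b + gens d \<alpha> a i"] B_add gens_in_B)
      qed
    next
      case False
      then show ?thesis using P k ij Suc(2) unfolding chain_def by auto
    qed
  qed (use P k Suc(2,3) in \<open>auto simp: chain_def\<close>)
  then show ?case by blast
qed

text \<open>A chain of p is continued by a chain of b translated by p. This lets the chains of two
  elements share a prescribed common summand.\<close>

lemma ex_chain_through:
  assumes "p \<in> B" "b \<in> B" "x = p + b"
  shows "\<exists>P. chain P x \<and> P (rank p) = p"
proof -
  obtain P Q where P: "chain P p" and Q: "chain Q b" using assms ex_chain by blast
  define R where "R = (\<lambda>i. if i \<le> rank p then P i else p + Q (i - rank p))"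
  have r: "rank x = rank p + rank b" using assms rank_add by simp
  have "chain R x"
    unfolding chain_def
  proof (intro conjI allI impI)
    have "Q 0 = 0" using Q rank_eq_0 unfolding chain_def by blast
    show "R (rank x) = x"
    proof (cases "rank b = 0")
      case True
      then show ?thesis using rank_eq_0[of b] assms P by (simp add: R_def chain_def)
    next
      case False
      then show ?thesis using assms Q r by (simp add: R_def chain_def)
    qed
    fix j assume j: "j \<le> rank x"
    show "R j \<in> B" "rank (R j) = j"
      using P Q j r assms rank_add by (auto simp: R_def chain_def B_add)
    fix i assume i: "i \<le> j"
    show "\<exists>b\<in>B. R j = R i + b"
    proof (cases "j \<le> rank p")
      case True
      then show ?thesis using P i unfolding R_def chain_def by auto
    next
      case jp: False
      show ?thesis
      proof (cases "i \<le> rank p")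
        case True
        then obtain b' where "b' \<in> B" "p = P i + b'" using chainD(4)[OF P] by blast
        then show ?thesis using True jp Q j r
          by (auto simp: R_def add.assoc chain_def intro!: bexI[of _ "b' + Q (j - rank p)"] B_add)
      next
        case False
        then obtain b' where "b' \<in> B" "Q (j - rank p) = Q (i - rank p) + b'"
          using Q i j r unfolding chain_def
          by (metis add_diff_cancel_left' diff_le_mono)
        then show ?thesis using False jp by (auto simp: R_def add.assoc)
      qed
    qed
  qed
  then show ?thesis using P by (intro exI[of _ R]) (auto simp: R_def chain_def)
qed

lemma chain_BA: "chain P x \<Longrightarrow> x \<in> B\<^sub>A \<Longrightarrow> j \<le> rank x \<Longrightarrow> P j \<in> B\<^sub>A"
  using chainD BA_summand by metis

lemma chain_le:
  assumes "chain P x" "i \<le> j" "j \<le> rank x" shows "lookup (P i) l \<le> lookup (P j) l"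
  using chainD(3)[OF assms(1,3,2)] by (auto simp: lookup_add)

text \<open>Partial sums increase coordinatewise, so congruent ones are comparable for
  \<open>leA\<close>; minimality makes them equal, and their ranks then agree.\<close>

lemma chain_eqmod:
  assumes "chain P x" "x \<in> B\<^sub>A" "i \<le> rank x" "j \<le> rank x" "eqmod \<alpha> (P i) (P j)"
  shows "i = j"
proof -
  have *: "i = j" if "i \<le> j" "i \<le> rank x" "j \<le> rank x" "eqmod \<alpha> (P i) (P j)" for i j
  proof -
    have "leA \<alpha> (P i) (P j)" using that chain_le assms by (auto simp: leA_def)
    then have "P i = P j" using BA_minimal chain_BA chainD assms that by metis
    then show ?thesis using chainD(2) assms that by metis
  qed
  show ?thesis
    using *[OF _ assms(3,4,5)] *[OF _ assms(4,3) eqmod_sym[OF assms(5)]] nat_le_linear[of i j] by blast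
qed

section \<open>Finiteness of the minimal elements and of their classes\<close>

lemma finite_bounded_vecs: "finite {x \<in> nvecs d. total x \<le> N}"
proof (rule finite_subset)
  show "{x \<in> nvecs d. total x \<le> N} \<subseteq> vec d ` (\<Pi>\<^sub>E i\<in>{..<d}. {..N})"
  proof
    fix x assume x: "x \<in> {x \<in> nvecs d. total x \<le> N}"
    then have "x = vec d (\<lambda>i\<in>{..<d}. lookup x i)"
      by (intro poly_mapping_eqI) (auto simp: nvecs_iff)
    moreover have "(\<lambda>i\<in>{..<d}. lookup x i) \<in> (\<Pi>\<^sub>E i\<in>{..<d}. {..N})"
      using x by (auto intro: le_trans[OF lookup_le_total])
    ultimately show "x \<in> vec d ` (\<Pi>\<^sub>E i\<in>{..<d}. {..N})" by blast
  qed
  show "finite (vec d ` (\<Pi>\<^sub>E i\<in>{..<d}. {..N}))"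
    by (intro finite_imageI finite_PiE) auto
qed

text \<open>Pigeonhole: a chain of x has rank x + 1 pairwise incongruent members, while there are
  only \<open>\<alpha> ^ d\<close> residue vectors.\<close>

lemma rank_BA_bound:
  assumes "x \<in> B\<^sub>A" shows "rank x < \<alpha> ^ d"
proof -
  obtain P where P: "chain P x" using ex_chain BA_in_B assms by blast
  define g where "g = (\<lambda>i. \<lambda>j\<in>{..<d}. lookup (P i) j mod \<alpha>)"
  have "inj_on g {..rank x}"
  proof (rule inj_onI)
    fix i j assume ij: "i \<in> {..rank x}" "j \<in> {..rank x}" "g i = g j"
    then have "eqmod \<alpha> (P i) (P j)"
      unfolding eqmod_def g_def
      by (metis (no_types, lifting) B_nvecs P atMost_iff chainD(1) lessThan_iff not_less nvecs_iff restrict_apply')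
    then show "i = j" using chain_eqmod P assms ij by auto
  qed
  moreover have "g ` {..rank x} \<subseteq> (\<Pi>\<^sub>E i\<in>{..<d}. {..<\<alpha>})"
    using \<alpha>_pos unfolding g_def by (intro image_subsetI) (simp add: PiE_iff)
  ultimately have "card {..rank x} \<le> card (\<Pi>\<^sub>E i\<in>{..<d}. {..<\<alpha>})"
    by (meson card_inj_on_le finite_PiE finite_lessThan)
  then show ?thesis by (simp add: card_PiE)
qed

lemma finite_BA: "finite B\<^sub>A"
proof (rule finite_subset[OF _ finite_bounded_vecs])
  show "B\<^sub>A \<subseteq> {x \<in> nvecs d. total x \<le> \<alpha> * \<alpha> ^ d}"
    using rank_BA_bound total_B BA_in_B B_nvecs by (auto simp: less_imp_le)
qed

definition classes_rel :: "(expo \<times> expo) set" where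
  "classes_rel = {(x, y). x \<in> B\<^sub>A \<and> y \<in> B\<^sub>A \<and> zvec x - zvec y \<in> groupA d \<alpha>}"

lemma classes_rel_iff: "(x, y) \<in> classes_rel \<longleftrightarrow> x \<in> B\<^sub>A \<and> y \<in> B\<^sub>A \<and> eqmod \<alpha> x y"
  using zvec_diff_in_groupA_iff BA_in_B B_nvecs by (auto simp: classes_rel_def)

abbreviation Classes where "Classes \<equiv> eqv_classes d \<alpha> c a"

lemma classes_eq: "Classes = B\<^sub>A // classes_rel"
  by (simp add: eqv_classes_def classes_rel_def)

lemma equiv_classes_rel: "equiv B\<^sub>A classes_rel"
  by (rule equivI) (auto simp: refl_on_def sym_def trans_def classes_rel_iff intro: eqmod_sym eqmod_trans)

lemma finite_classes: "finite Classes"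
  unfolding classes_eq using finite_BA equiv_type[OF equiv_classes_rel] by (rule finite_quotient)

lemma classD:
  assumes "\<Gamma> \<in> Classes"
  shows "\<Gamma> \<subseteq> B\<^sub>A" "\<Gamma> \<noteq> {}" "x \<in> \<Gamma> \<Longrightarrow> y \<in> \<Gamma> \<longleftrightarrow> y \<in> B\<^sub>A \<and> eqmod \<alpha> x y" "finite \<Gamma>"
proof -
  show *: "\<Gamma> \<subseteq> B\<^sub>A" "\<Gamma> \<noteq> {}"
    using assms equiv_classes_rel unfolding classes_eq
    by (metis in_quotient_imp_subset, metis in_quotient_imp_non_empty)
  show "finite \<Gamma>" using * finite_BA finite_subset by blast
  assume x: "x \<in> \<Gamma>"
  have "(x, y) \<in> classes_rel" if "y \<in> \<Gamma>"
    by (rule in_quotient_imp_in_rel[OF equiv_classes_rel assms[unfolded classes_eq]]) (use x that in auto)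
  moreover have "y \<in> \<Gamma>" if "(x, y) \<in> classes_rel"
    by (rule in_quotient_imp_closed[OF equiv_classes_rel assms[unfolded classes_eq] x that])
  ultimately show "y \<in> \<Gamma> \<longleftrightarrow> y \<in> B\<^sub>A \<and> eqmod \<alpha> x y"
    using x *(1) classes_rel_iff[of x y] by blast
qed

lemma card_le_classes:
  assumes "S \<subseteq> B\<^sub>A" "\<And>x y. x \<in> S \<Longrightarrow> y \<in> S \<Longrightarrow> eqmod \<alpha> x y \<Longrightarrow> x = y"
  shows "card S \<le> card Classes"
proof (rule card_inj_on_le[OF _ _ finite_classes])
  show "inj_on (\<lambda>x. classes_rel `` {x}) S"
  proof (rule inj_onI)
    fix x y assume xy: "x \<in> S" "y \<in> S" "classes_rel `` {x} = classes_rel `` {y}"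
    then have "(x, y) \<in> classes_rel"
      using eq_equiv_class_iff[OF equiv_classes_rel, of x y] assms(1) by blast
    then show "x = y" using assms(2) xy by (simp add: classes_rel_iff)
  qed
  show "(\<lambda>x. classes_rel `` {x}) ` S \<subseteq> Classes"
    using assms by (auto simp: classes_eq quotientI)
qed

text \<open>A minimal element below x is congruent to x and therefore belongs to the class. In a
  two-element class this leaves just two candidates for z, which drives the exchange argument in
  \<open>rank_le_pair_class\<close>.\<close>

lemma class_below:
  assumes "\<Gamma> \<in> Classes" "m \<in> \<Gamma>" "x \<in> B" "eqmod \<alpha> m x"
  shows "\<exists>z\<in>\<Gamma>. leA \<alpha> z x"
proof -
  obtain z where z: "z \<in> B\<^sub>A" "leA \<alpha> z x" using BA_below assms by blast
  then have "eqmod \<alpha> m z" using assms eqmod_sym eqmod_trans leA_imp_eqmod by blast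
  then show ?thesis using classD(3)[OF assms(1,2)] z by blast
qed

end

section \<open>Lower bounds for the number of classes\<close>

context simplicial_semigroup
begin

lemma eqmod_low_rank:
  assumes "x \<in> insert 0 (a ` {..<c})" "y \<in> B\<^sub>A" "eqmod \<alpha> x y"
  shows "y = x"
  using assms eqmod_a_BA eqmod_zero_BA eqmod_sym by auto

lemma card_low_rank: "card (insert 0 (a ` {..<c})) = c + 1"
  using a_nonzero by (subst card_insert_disjoint) (auto simp: card_image inj_a)

lemma rank_low_rank: "x \<in> insert 0 (a ` {..<c}) \<Longrightarrow> rank x < 2"
  using rank_a by auto

lemma low_rank_BA: "insert 0 (a ` {..<c}) \<subseteq> B\<^sub>A"
  using zero_in_BA a_in_BA by auto

text \<open>The classes of 0 and of the \<open>a i\<close> contain no further elements, so elements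
  of rank at least 2 lie in other classes and both counts add up.\<close>

lemma card_classes_ge_add:
  assumes "S \<subseteq> B\<^sub>A" "\<And>x. x \<in> S \<Longrightarrow> rank x \<ge> 2" "finite S"
    and "\<And>x y. x \<in> S \<Longrightarrow> y \<in> S \<Longrightarrow> eqmod \<alpha> x y \<Longrightarrow> x = y"
  shows "c + 1 + card S \<le> card Classes"
proof -
  let ?L = "insert 0 (a ` {..<c})"
  have d: "?L \<inter> S = {}" using assms(2) rank_low_rank by (meson disjoint_iff not_less)
  have "card (?L \<union> S) \<le> card Classes"
  proof (rule card_le_classes)
    show "?L \<union> S \<subseteq> B\<^sub>A" using assms low_rank_BA by blast
    fix x y assume xy: "x \<in> ?L \<union> S" "y \<in> ?L \<union> S" "eqmod \<alpha> x y"
    then have "y \<in> B\<^sub>A" "x \<in> B\<^sub>A" using assms low_rank_BA by blast+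
    then show "x = y"
      using xy assms(4)[of x y] eqmod_low_rank[of x y] eqmod_low_rank[of y x] eqmod_sym by blast
  qed
  moreover have "card (?L \<union> S) = card ?L + card S"
    using d assms by (intro card_Un_disjoint) auto
  ultimately show ?thesis using card_low_rank by linarith
qed

lemma card_chain_image:
  assumes "chain P x" "I \<subseteq> {..rank x}" shows "card (P ` I) = card I"
proof (rule card_image, rule inj_onI)
  fix i j assume "i \<in> I" "j \<in> I" "P i = P j"
  then show "i = j" using chainD(2)[OF assms(1)] assms(2) by (metis atMost_iff subsetD)
qed

lemma rank_le_singleton_class:
  assumes "{m} \<in> Classes" shows "c + rank m \<le> card Classes"
proof -
  have m: "m \<in> B\<^sub>A" using classD(1)[OF assms] by auto
  obtain P where P: "chain P m" using ex_chain m BA_in_B by blast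
  \<comment> \<open>Ranks 2 up to rank m contribute rank m - 1 classes besides the c + 1 classes of
    smaller rank.\<close>
  have "c + 1 + card (P ` {2..rank m}) \<le> card Classes"
  proof (rule card_classes_ge_add)
    fix x y assume "x \<in> P ` {2..rank m}" "y \<in> P ` {2..rank m}" and e: "eqmod \<alpha> x y"
    then obtain i j where "x = P i" "y = P j" "i \<le> rank m" "j \<le> rank m" by auto
    then show "x = y" using chain_eqmod[OF P m, of i j] e by simp
  qed (use chain_BA[OF P m] chainD(2)[OF P] in auto)
  then show ?thesis using card_chain_image[OF P, of "{2..rank m}"] by auto
qed

text \<open>
  The two chains are chosen to share a common summand of \<open>m\<close> and \<open>n\<close> of maximal rank; any
  congruence between their remaining members would produce a larger common summand.
\<close>

lemma rank_le_pair_class: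
  assumes \<Gamma>: "{m, n} \<in> Classes" and ne: "m \<noteq> n"
    and h: "\<And>x. (\<And>i. lookup x i \<le> lookup m i) \<Longrightarrow> (\<And>i. lookup x i \<le> lookup n i) \<Longrightarrow> total x \<le> \<alpha> * r"
    and r: "1 \<le> r" "r < rank m" "r < rank n"
  shows "c + rank m + rank n \<le> card Classes + 1 + r"
proof -
  have mn: "m \<in> B\<^sub>A" "n \<in> B\<^sub>A" "eqmod \<alpha> m n" using classD(1,3)[OF \<Gamma>] by auto
  define C where "C = {p \<in> B. (\<exists>b\<in>B. m = p + b) \<and> (\<exists>b\<in>B. n = p + b)}"
  have C_rank: "rank p \<le> r" if "p \<in> C" for p
  proof -
    have "total p \<le> \<alpha> * r" using h[of p] that by (auto simp: C_def lookup_add)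
    then show ?thesis using that total_B \<alpha>_pos by (simp add: C_def)
  qed
  have "0 \<in> C" using BA_in_B[OF mn(1)] BA_in_B[OF mn(2)] B_zero by (simp add: C_def)
  then have "\<exists>p. p \<in> C \<and> (\<forall>q. q \<in> C \<longrightarrow> rank q \<le> rank p)"
    by (rule ex_has_greatest_nat[where b = "Suc r"]) (use C_rank in \<open>auto simp: less_Suc_eq_le\<close>)
  then obtain p where p: "p \<in> C" "\<And>q. q \<in> C \<Longrightarrow> rank q \<le> rank p"
    by blast
  obtain P Q where P: "chain P m" "P (rank p) = p" and Q: "chain Q n" "Q (rank p) = p"
  proof -
    obtain b b' where "p \<in> B" "b \<in> B" "m = p + b" "b' \<in> B" "n = p + b'"
      using p(1) unfolding C_def by blast
    then show ?thesis using that ex_chain_through[of p b m] ex_chain_through[of p b' n] by blast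
  qed
  define s where "s = rank p"
  have s: "s \<le> r" using C_rank p s_def by simp
  have PQ: False if ij: "i \<le> rank m" "s < j" "j < rank n" and e: "eqmod \<alpha> (P i) (Q j)" for i j
  proof (cases "i \<le> s")
    case True
    \<comment> \<open>Here \<open>P i\<close> is a partial sum of p, and p is a partial sum of
      \<open>Q j\<close>.\<close>
    have "lookup (P i) l \<le> lookup (Q j) l" for l
      using chain_le[OF P(1) True] chain_le[OF Q(1), of s j] P(2) Q(2) s r ij unfolding s_def[symmetric]
      by (metis less_imp_le order_trans)
    then have "leA \<alpha> (P i) (Q j)" using e by (simp add: leA_def)
    then have "P i = Q j"
      using BA_minimal chain_BA[OF Q(1) mn(2)] chainD(1)[OF P(1)] ij by simp
    then show False using chainD(2)[OF P(1)] chainD(2)[OF Q(1)] ij True by (metis less_imp_le not_less)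
  next
    case False
    obtain m' where m': "m' \<in> B" "m = P i + m'" using chainD(4)[OF P(1) ij(1)] by blast
    obtain n' where n': "n' \<in> B" "n = Q j + n'" using chainD(4)[OF Q(1) less_imp_le[OF ij(3)]] by blast
    have Pi: "P i \<in> B" "rank (P i) = i" "P i \<in> B\<^sub>A" and Qj: "Q j \<in> B" "rank (Q j) = j" "Q j \<in> B\<^sub>A"
      using chainD(1,2)[OF P(1) ij(1)] chainD(1,2)[OF Q(1) less_imp_le[OF ij(3)]]
        chain_BA[OF P(1) mn(1) ij(1)] chain_BA[OF Q(1) mn(2) less_imp_le[OF ij(3)]] by auto
    \<comment> \<open>Exchange of remainders: what \<open>P i\<close> lacks of m is attached to
      \<open>Q j\<close>. The result is in B and congruent to m, hence above m or above n.\<close>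
    have "eqmod \<alpha> m (Q j + m')" using e m' eqmod_add by simp
    then obtain z where z: "z \<in> {m, n}" "leA \<alpha> z (Q j + m')"
      using class_below[OF \<Gamma>, of m "Q j + m'"] Qj m' B_add by blast
    then consider "leA \<alpha> m (Q j + m')" | "leA \<alpha> n (Q j + m')" by blast
    then show False
    proof cases
      \<comment> \<open>Cancelling \<open>m'\<close> leads to \<open>P i = Q j\<close>, a common
        summand of rank i > s.\<close>
      case 1
      then have "leA \<alpha> (P i) (Q j)" unfolding m'(2) using leA_add_left by (metis add.commute)
      then have "P i = Q j" using BA_minimal Pi Qj by blast
      then have "P i \<in> C" using m' n' Pi unfolding C_def by auto
      then show False using p(2) Pi False s_def by force
    next
      case 2
      then have "leA \<alpha> n' m'" unfolding n'(2) using leA_add_left by blast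
      moreover have "m' \<in> B\<^sub>A" using BA_summand[of m' "P i"] m' Pi mn by (simp add: add.commute)
      ultimately have nm: "n' = m'" using BA_minimal n' by blast
      obtain b where b: "b \<in> B" "P i = p + b" using chainD(3)[OF P(1) ij(1), of s] P(2) False s_def by auto
      obtain b' where b': "b' \<in> B" "Q j = p + b'" using chainD(3)[OF Q(1), of j s] Q(2) ij s_def by auto
      have pB: "p \<in> B" using p unfolding C_def by blast
      have "m = (p + n') + b" "n = (p + n') + b'" using m' n' nm b b' by (simp_all add: ac_simps)
      \<comment> \<open>The two remainders coincide, so \<open>n'\<close> can be added to p as a
        common summand; maximality of p forces rank 0 for \<open>n'\<close>, against j < rank
        n.\<close>
      then have "p + n' \<in> C" unfolding C_def using b b' pB n' B_add by blast
      then have "rank n' = 0" using p(2)[of "p + n'"] rank_add[OF pB n'(1)] by simp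
      moreover have "rank n = rank (Q j) + rank n'" using n' Qj rank_add by simp
      ultimately show False using Qj ij by simp
    qed
  qed
  \<comment> \<open>The second range begins after the shared summand p and stops before n, which is
    congruent to m. Since s \<le> r and 1 \<le> r, its lower end is at most r + 1, so it has at
    least rank n - r - 1 elements.\<close>
  let ?I = "{2..rank m}" and ?J = "{max (s + 1) 2..rank n - 1}"
  have PQ': False if "i \<in> ?I" "j \<in> ?J" "eqmod \<alpha> (P i) (Q j)" for i j
  proof -
    have "i \<le> rank m" "s < j" "j < rank n" using that r by auto
    then show False using PQ that(3) by blast
  qed
  have "c + 1 + card (P ` ?I \<union> Q ` ?J) \<le> card Classes"
  proof (rule card_classes_ge_add)
    show "P ` ?I \<union> Q ` ?J \<subseteq> B\<^sub>A" using chain_BA[OF P(1) mn(1)] chain_BA[OF Q(1) mn(2)] by auto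
    show "rank x \<ge> 2" if "x \<in> P ` ?I \<union> Q ` ?J" for x
      using that chainD(2)[OF P(1)] chainD(2)[OF Q(1)] by auto
    show "x = y" if "x \<in> P ` ?I \<union> Q ` ?J" "y \<in> P ` ?I \<union> Q ` ?J" and e: "eqmod \<alpha> x y" for x y
      using that(1,2)
    proof (elim UnE imageE)
      fix i j assume "x = P i" "y = P j" "i \<in> ?I" "j \<in> ?I"
      then show ?thesis using chain_eqmod[OF P(1) mn(1), of i j] e by simp
    next
      fix i j assume "x = Q i" "y = Q j" "i \<in> ?J" "j \<in> ?J"
      moreover from this have "i \<le> rank n" "j \<le> rank n" by auto
      ultimately show ?thesis using chain_eqmod[OF Q(1) mn(2), of i j] e by simp
    next
      fix i j assume "x = P i" "y = Q j" "i \<in> ?I" "j \<in> ?J"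
      then show ?thesis using PQ'[of i j] e by blast
    next
      fix i j assume "x = Q j" "y = P i" "i \<in> ?I" "j \<in> ?J"
      then show ?thesis using PQ'[of i j] eqmod_sym[OF e] by blast
    qed
  qed auto
  moreover have "P ` ?I \<inter> Q ` ?J = {}"
  proof (rule ccontr)
    assume "P ` ?I \<inter> Q ` ?J \<noteq> {}"
    then obtain i j where "i \<in> ?I" "j \<in> ?J" "P i = Q j" by blast
    then show False using PQ'[of i j] by simp
  qed
  then have "card (P ` ?I \<union> Q ` ?J) = card ?I + card ?J"
    using card_chain_image[OF P(1), of ?I] card_chain_image[OF Q(1), of ?J]
    by (subst card_Un_disjoint) auto
  ultimately show ?thesis using r s by auto
qed

text \<open>
  For a one-element class \<open>m = n\<close>, the exponents \<open>u\<close> and \<open>v\<close> vanish and the truncated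
  subtraction gives 0.
\<close>

lemma class_inequality:
  assumes \<Gamma>: "\<Gamma> \<in> Classes" "card \<Gamma> \<le> 2"
  obtains u v where "u \<in> nvecs d" "v \<in> nvecs d"
    "(\<lambda>x. quot_vec d \<alpha> x (hvec d \<Gamma>)) ` \<Gamma> = {u, v}"
    "\<And>i. min (lookup u i) (lookup v i) = 0"
    "real (total u + total v - 1) + vdeg \<alpha> (hvec d \<Gamma>) + real c \<le> real (card Classes)"
proof -
  have hvec: "hvec d \<Gamma> = vec d (\<lambda>i. Min ((\<lambda>m. lookup m i) ` \<Gamma>))"
    by (simp add: hvec_def vec_def)
  have quot: "quot_vec d \<alpha> x h = vec d (\<lambda>i. (lookup x i - lookup h i) div \<alpha>)" for x h
    by (simp add: quot_vec_def vec_def)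
  obtain m n where mn: "\<Gamma> = {m, n}"
  proof -
    have "card \<Gamma> \<noteq> 0" using classD[OF \<Gamma>(1)] by simp
    then have "card \<Gamma> = 1 \<or> card \<Gamma> = 2" using \<Gamma>(2) by linarith
    then show ?thesis using that by (auto simp: card_1_singleton_iff card_2_iff)
  qed
  have BA: "m \<in> B\<^sub>A" "n \<in> B\<^sub>A" and e: "eqmod \<alpha> m n" using classD(1,3)[OF \<Gamma>(1)] mn by auto
  note B = BA_in_B[OF BA(1)] BA_in_B[OF BA(2)]
  have nv: "m \<in> nvecs d" "n \<in> nvecs d" using B B_nvecs by auto
  define h where "h = hvec d \<Gamma>"
  have lh: "lookup h i = min (lookup m i) (lookup n i)" for i
    using nv unfolding h_def hvec by (auto simp: mn nvecs_iff)
  have hn: "h \<in> nvecs d" unfolding h_def hvec by simp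
  define u v where "u = quot_vec d \<alpha> m h" and "v = quot_vec d \<alpha> n h"
  have dv: "\<alpha> dvd lookup m i - lookup h i" "\<alpha> dvd lookup n i - lookup h i" for i
    using e unfolding eqmod_def lh by (metis min_le_iff_disj mod_eq_dvd_iff_nat min_def order_refl dvd_0_right diff_self_eq_0 nle_le)+
  have lm: "lookup m i = lookup h i + \<alpha> * lookup u i" for i
  proof (cases "i < d")
    case True
    then show ?thesis using dv(1)[of i] by (simp add: u_def quot lh)
  qed (use nv hn in \<open>auto simp: nvecs_iff u_def quot\<close>)
  have ln: "lookup n i = lookup h i + \<alpha> * lookup v i" for i
  proof (cases "i < d")
    case True
    then show ?thesis using dv(2)[of i] by (simp add: v_def quot lh)
  qed (use nv hn in \<open>auto simp: nvecs_iff v_def quot\<close>)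
  have uv: "u \<in> nvecs d" "v \<in> nvecs d" by (auto simp: u_def v_def quot)
  \<comment> \<open>The minimum defining the coordinate of h is attained at m or at n.\<close>
  have disj: "min (lookup u i) (lookup v i) = 0" for i
  proof (rule ccontr)
    assume "min (lookup u i) (lookup v i) \<noteq> 0"
    then have "\<alpha> * lookup u i > 0" "\<alpha> * lookup v i > 0" using \<alpha>_pos by (auto simp: min_def split: if_splits)
    then show False using lh[of i] lm[of i] ln[of i] by linarith
  qed
  have tm: "total m = total h + \<alpha> * total u" and tn: "total n = total h + \<alpha> * total v"
    using nv hn uv by (simp_all add: total_eq_sum[of _ d] lm ln sum.distrib sum_distrib_left)
  define r where "r = total h div \<alpha>"
  have "\<alpha> dvd total h" using tm B_props[OF B(1)] by (metis dvd_add_times_triv_right_iff mult.commute)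
  then have th: "total h = \<alpha> * r" by (simp add: r_def)
  have rm: "rank m = r + total u" and rn: "rank n = r + total v"
    using tm tn th \<alpha>_pos by (simp_all add: rank_def flip: distrib_left)
  have vh: "vdeg \<alpha> h = real r" using th \<alpha>_pos by (simp add: vdeg_def)
  have "c + (total u + total v - 1) + r \<le> card Classes"
  proof (cases "m = n")
    case True
    then have "u = v" by (simp add: u_def v_def)
    then have "total u = 0" using disj by (auto simp: total_eq_0_iff intro!: poly_mapping_eqI)
    then show ?thesis
      using rank_le_singleton_class[of m] \<Gamma>(1) mn True rm \<open>u = v\<close> by simp
  next
    case False
    have u0: "total u > 0"
    proof (rule ccontr)
      assume "\<not> total u > 0"
      then have "lookup u i = 0" for i using lookup_le_total[of u i] by simp
      then have "leA \<alpha> m n" using lm ln e by (auto simp: leA_def)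
      then show False using BA_minimal BA B False by blast
    qed
    have v0: "total v > 0"
    proof (rule ccontr)
      assume "\<not> total v > 0"
      then have "lookup v i = 0" for i using lookup_le_total[of v i] by simp
      then have "leA \<alpha> n m" using lm ln e by (auto simp: leA_def eqmod_sym)
      then show False using BA_minimal BA B False by blast
    qed
    \<comment> \<open>For h = 0 both m and n would be congruent to 0, and 0 is the only such element
      of \<open>B\<^sub>A\<close>. This provides the hypothesis 1 \<le> r of the counting
      lemma.\<close>
    have "r \<noteq> 0"
    proof
      assume "r = 0"
      then have "h = 0" using th total_eq_0_iff by simp
      then have "eqmod \<alpha> m 0" "eqmod \<alpha> n 0" using lm ln by (auto simp: eqmod_def)
      then show False using eqmod_zero_BA BA False by blast
    qed
    moreover have "total x \<le> \<alpha> * r"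
      if "\<And>i. lookup x i \<le> lookup m i" "\<And>i. lookup x i \<le> lookup n i" for x
      unfolding th[symmetric] by (rule total_mono) (simp add: lh that)
    ultimately have "c + rank m + rank n \<le> card Classes + 1 + r"
      using rank_le_pair_class[of m n r] \<Gamma>(1) mn False rm rn u0 v0 by simp
    then show ?thesis using rm rn u0 v0 by linarith
  qed
  then have "real (total u + total v - 1) + vdeg \<alpha> h + real c \<le> real (card Classes)"
    unfolding vh by (simp flip: of_nat_add) 
  then show ?thesis using that uv disj mn by (simp add: u_def v_def h_def)
qed

end

section \<open>Laurent coefficients of localized monomial ideals\<close>

lemma keys_uminus [simp]: "keys (- p) = keys p" for p :: "'a \<Rightarrow>\<^sub>0 'b::ab_group_add"
  by (auto simp: in_keys_iff)

lemma keys_mult_subset: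
  assumes "keys p \<subseteq> X" "keys q \<subseteq> Y" "\<And>x y. x \<in> X \<Longrightarrow> y \<in> Y \<Longrightarrow> x + y \<in> Z"
  shows "keys (p * q) \<subseteq> Z"
  using keys_mult[of p q] assms by blast

lemma keys_add_subset: "keys p \<subseteq> X \<Longrightarrow> keys q \<subseteq> X \<Longrightarrow> keys (p + q) \<subseteq> X"
  using keys_add[of p q] by blast

lemma mpoly_eq_sum: "p = (\<Sum>u\<in>keys p. single u (lookup p u))"
  by (rule poly_mapping_eqI) (simp add: lookup_sum lookup_single when_def in_keys_iff)

lemma mmonom_mult: "mmonom u * mmonom v = mmonom (u + v)"
  by (simp add: mmonom_def mult_single)

lemma mmonom_zero: "mmonom 0 = 1"
  by (simp add: mmonom_def)

definition pw :: "nat set \<Rightarrow> nat \<Rightarrow> expo" where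
  "pw S l = (\<Sum>i\<in>S. single i l)"

lemma lookup_pw: "finite S \<Longrightarrow> lookup (pw S l) i = (if i \<in> S then l else 0)"
  by (simp add: pw_def lookup_sum lookup_single when_def)

lemma vprod_eq: "finite S \<Longrightarrow> vprod S = mmonom (pw S 1)"
  unfolding vprod_def pw_def
  by (induction S rule: finite_induct) (auto simp: mvar_def mmonom_mult mmonom_zero)

lemma vprod_power: "finite S \<Longrightarrow> vprod S ^ l = mmonom (pw S l)"
proof (induction l)
  case 0
  then show ?case by (simp add: pw_def mmonom_zero)
next
  case (Suc l)
  have "pw S 1 + pw S l = pw S (Suc l)"
    using Suc.prems by (intro poly_mapping_eqI) (simp add: lookup_add lookup_pw)
  then show ?case using Suc by (simp add: vprod_eq mmonom_mult)
qed

lemma vprod_nonzero: "finite S \<Longrightarrow> (vprod S :: 'k::field mpoly) \<noteq> 0"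
  by (simp add: vprod_eq mmonom_def) (metis lookup_single_eq lookup_zero one_neq_zero)

text \<open>
  Exponents of Laurent monomials are functions \<open>nat \<Rightarrow> int\<close>; \<open>ext p\<close> extends the coefficients of
  \<open>p\<close> by zero to all of them.
\<close>

definition vecz :: "expo \<Rightarrow> nat \<Rightarrow> int" where "vecz u = (\<lambda>i. int (lookup u i))"

lemma vecz_inj: "vecz u = vecz v \<longleftrightarrow> u = v"
  by (auto simp: vecz_def fun_eq_iff intro: poly_mapping_eqI)

definition ext :: "'k::field mpoly \<Rightarrow> (nat \<Rightarrow> int) \<Rightarrow> 'k" where
  "ext p w = (\<Sum>u\<in>keys p. if vecz u = w then lookup p u else 0)"

lemma ext_vecz: "ext p (vecz u) = lookup p u"
  by (simp add: ext_def vecz_inj in_keys_iff)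

lemma ext_outside: "w \<notin> range vecz \<Longrightarrow> ext p w = 0"
  by (auto simp: ext_def intro!: sum.neutral)

lemma ext_eqI: "(\<And>w. ext p w = ext q w) \<Longrightarrow> p = q"
  by (metis ext_vecz poly_mapping_eqI)

lemma ext_add: "ext (p + q) w = ext p w + ext q w"
  by (cases "w \<in> range vecz") (auto simp: ext_vecz ext_outside lookup_add)

lemma ext_uminus: "ext (- p) w = - ext p w"
  by (cases "w \<in> range vecz") (auto simp: ext_vecz ext_outside)

lemma ext_zero: "ext 0 w = 0"
  by (simp add: ext_def)

lemma ext_sum: "ext (sum f I) w = (\<Sum>i\<in>I. ext (f i) w)"
  by (induction I rule: infinite_finite_induct) (auto simp: ext_zero ext_add)

lemma ext_single: "ext (single u x) w = (if vecz u = w then x else 0)"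
  by (simp add: ext_def)

lemma ext_sign: "ext ((- 1) ^ n * p) w = (- 1) ^ n * ext p w"
  by (induction n) (auto simp: ext_uminus)

lemma ext_mmonom_mult: "ext (mmonom v * p) w = ext p (\<lambda>i. w i - int (lookup v i))"
proof -
  have "mmonom v * p = (\<Sum>u\<in>keys p. single (v + u) (lookup p u))"
    by (subst mpoly_eq_sum[of p]) (simp add: mmonom_def sum_distrib_left mult_single)
  moreover have "vecz (v + u) = w \<longleftrightarrow> vecz u = (\<lambda>i. w i - int (lookup v i))" for u
    by (auto simp: vecz_def lookup_add fun_eq_iff algebra_simps)
  ultimately show ?thesis by (simp add: ext_sum ext_single) (simp add: ext_def)
qed

definition shift :: "nat set \<Rightarrow> int \<Rightarrow> (nat \<Rightarrow> int) \<Rightarrow> nat \<Rightarrow> int" where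
  "shift S k w = (\<lambda>i. w i + (if i \<in> S then k else 0))"

lemma shift_shift: "shift S k (shift S l w) = shift S (k + l) w"
  by (auto simp: shift_def)

lemma shift_zero [simp]: "shift S 0 w = w"
  by (auto simp: shift_def)

lemma shift_inj: "shift S k w = shift S k w' \<longleftrightarrow> w = w'"
  by (auto simp: shift_def fun_eq_iff)

lemma ext_vprod_power_mult:
  assumes "finite S" shows "ext (vprod S ^ l * p) w = ext p (shift S (- int l) w)"
proof -
  have "(\<lambda>i. w i - int (lookup (pw S l) i)) = shift S (- int l) w"
    using assms by (auto simp: shift_def lookup_pw)
  then show ?thesis using assms by (simp add: vprod_power ext_mmonom_mult)
qed

text \<open>The Laurent coefficients of the fraction \<open>p / (\<Prod>i\<in>S. x\<^sub>i)\<^sup>k\<close>.\<close>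

definition fc :: "nat set \<Rightarrow> 'k::field mpoly \<Rightarrow> nat \<Rightarrow> (nat \<Rightarrow> int) \<Rightarrow> 'k" where
  "fc S p k w = ext p (shift S (int k) w)"

text \<open>Shifting the exponents by k + l clears both denominators, and a polynomial is determined
  by its coefficients \<open>ext\<close>.\<close>

lemma fc_eq_iff:
  assumes "finite S"
  shows "fc S p k = fc S q l \<longleftrightarrow> vprod S ^ l * p = vprod S ^ k * q"
proof
  assume e: "fc S p k = fc S q l"
  show "vprod S ^ l * p = vprod S ^ k * q"
  proof (rule ext_eqI)
    fix w
    have "fc S p k (shift S (- int k - int l) w) = fc S q l (shift S (- int k - int l) w)"
      using e by simp
    then show "ext (vprod S ^ l * p) w = ext (vprod S ^ k * q) w"
      using assms by (simp add: ext_vprod_power_mult fc_def shift_shift)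
  qed
next
  assume e: "vprod S ^ l * p = vprod S ^ k * q"
  show "fc S p k = fc S q l"
  proof
    fix w
    have "ext (vprod S ^ l * p) (shift S (int k + int l) w) = ext (vprod S ^ k * q) (shift S (int k + int l) w)"
      using e by simp
    then show "fc S p k w = fc S q l w"
      using assms by (simp add: ext_vprod_power_mult fc_def shift_shift)
  qed
qed

lemma fc_sum_fractions:
  assumes "finite S"
  shows "fc S (vprod S ^ l * p + vprod S ^ k * q) (k + l) w = fc S p k w + fc S q l w"
  using assms by (simp add: fc_def ext_add ext_vprod_power_mult shift_shift)

text \<open>The span of the monomials with exponents in E. The record has the same fields as
  \<open>idealI\<close>, so that \<open>idealI_eq\<close> can be an equality of records instead of
  an isomorphism.\<close>

definition mono_module :: "expo set \<Rightarrow> ('k::field mpoly, 'k mpoly) gmodule" where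
  "mono_module E = \<lparr>carrier = {p. keys p \<subseteq> E}, mult = (*), one = 1, zero = 0, add = (+), smult = (*),
     hcomp = (\<lambda>r. {q \<in> {p. keys p \<subseteq> E}. \<forall>u\<in>keys q. int (total u) = r})\<rparr>"

lemma mono_module_simps [simp]:
  "carrier (mono_module E) = {p. keys p \<subseteq> E}" "add (mono_module E) = (+)"
  "zero (mono_module E) = 0" "smult (mono_module E) = (*)"
  "hcomp (mono_module E) r = {p. keys p \<subseteq> E \<and> (\<forall>u\<in>keys p. int (total u) = r)}"
  by (auto simp: mono_module_def)

locale monomial_ideal =
  fixes d :: nat and E :: "expo set"
  assumes E_nvecs: "E \<subseteq> nvecs d"
    and E_up: "u \<in> E \<Longrightarrow> v \<in> nvecs d \<Longrightarrow> u + v \<in> E"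
begin

abbreviation M :: "('k::field mpoly, 'k mpoly) gmodule" where "M \<equiv> mono_module E"

lemma carrier_mmonom_mult:
  assumes "keys p \<subseteq> E" "v \<in> nvecs d" shows "keys (mmonom v * p) \<subseteq> E"
proof
  fix u assume "u \<in> keys (mmonom v * p)"
  then obtain u' where "u' \<in> keys p" "u = v + u'"
    using keys_mult[of "mmonom v" p] by (auto simp: mmonom_def split: if_splits)
  then show "u \<in> E" using E_up[of u' v] assms by (auto simp: add.commute)
qed

lemma carrier_sign: "keys p \<subseteq> E \<Longrightarrow> keys ((- 1) ^ n * p) \<subseteq> E" for p :: "'k::field mpoly"
  by (induction n) (auto simp: in_keys_iff subset_iff)

lemma pw_nvecs: "S \<subseteq> {..<d} \<Longrightarrow> pw S l \<in> nvecs d"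
  using finite_subset[of S "{..<d}"] by (auto simp: nvecs_iff lookup_pw)

lemma carrier_vprod_mult:
  assumes "keys p \<subseteq> E" "S \<subseteq> {..<d}" shows "keys (vprod S ^ l * p) \<subseteq> E"
  using assms finite_subset[of S "{..<d}"] by (simp add: vprod_power carrier_mmonom_mult pw_nvecs)

text \<open>The additional power of the denominator allowed by \<open>loc_rel\<close> cancels,
  because polynomials form a domain. Fractions may therefore be identified with their Laurent
  coefficients.\<close>

lemma loc_rel_iff:
  assumes "finite S"
  shows "((p :: 'k::field mpoly, k), (q, l)) \<in> loc_rel (vprod S) M \<longleftrightarrow> keys p \<subseteq> E \<and> keys q \<subseteq> E \<and> fc S p k = fc S q l"
proof -
  have "vprod S ^ n * x = vprod S ^ n * y \<longleftrightarrow> x = y" for n and x y :: "'k::field mpoly"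
    using vprod_nonzero[OF assms, where 'k='k] mult_left_cancel[of "vprod S ^ n" x y] by simp
  then show ?thesis
    unfolding loc_rel_def fc_eq_iff[OF assms] by simp
qed

lemma mfrac_eq:
  assumes "finite S" "keys p \<subseteq> E"
  shows "mfrac (vprod S) M p k = {(q, l). keys q \<subseteq> E \<and> fc S q l = fc S p k}"
  using assms by (auto simp: mfrac_def loc_rel_iff)

lemma mfrac_eq_iff:
  assumes "finite S" "keys p \<subseteq> E" "keys q \<subseteq> E"
  shows "mfrac (vprod S) M p k = mfrac (vprod S) M q l \<longleftrightarrow> fc S p k = fc S q l"
  using assms by (auto simp: mfrac_eq)

text \<open>The representative chosen is irrelevant on the localization, by \<open>lc_mfrac\<close>;
  there the map is injective by \<open>lc_eqI\<close>.\<close>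

definition lc :: "nat set \<Rightarrow> ('k::field mpoly \<times> nat) set \<Rightarrow> (nat \<Rightarrow> int) \<Rightarrow> 'k" where
  "lc S X = (let (p, k) = (SOME x. x \<in> X) in fc S p k)"

lemma lc_mfrac:
  assumes "finite S" "keys p \<subseteq> E"
  shows "lc S (mfrac (vprod S) M p k) = fc S p k"
proof -
  have "(p, k) \<in> mfrac (vprod S) M p k" using assms by (simp add: mfrac_eq)
  then have "(SOME x. x \<in> mfrac (vprod S) M p k) \<in> mfrac (vprod S) M p k" by (rule someI)
  then show ?thesis using assms by (auto simp: lc_def mfrac_eq split: prod.splits)
qed

lemma mloc_carrier:
  "carrier (mloc M S) = {mfrac (vprod S) M p k | p k. keys p \<subseteq> E}"
  by (auto simp: mloc_def localization_def quotient_def mfrac_def)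

lemma lc_eqI:
  assumes "finite S" "X \<in> carrier (mloc M S)" "Y \<in> carrier (mloc M S)" "lc S X = lc S Y"
  shows "X = Y"
proof -
  obtain p k q l where p: "keys p \<subseteq> E" "X = mfrac (vprod S) M p k"
    and q: "keys q \<subseteq> E" "Y = mfrac (vprod S) M q l"
    using assms unfolding mloc_carrier by blast
  then show ?thesis using assms(4) by (simp add: lc_mfrac mfrac_eq_iff assms(1))
qed

lemma mloc_zero:
  assumes "finite S"
  shows "\<zero>\<^bsub>mloc M S\<^esub> \<in> carrier (mloc M S)" "lc S \<zero>\<^bsub>mloc M S\<^esub> w = 0"
proof -
  have z: "\<zero>\<^bsub>mloc M S\<^esub> = mfrac (vprod S) M 0 0" by (simp add: mloc_def localization_def)
  show "\<zero>\<^bsub>mloc M S\<^esub> \<in> carrier (mloc M S)"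
    unfolding z mloc_carrier by (auto intro!: exI[of _ 0] exI[of _ "0::nat"])
  show "lc S \<zero>\<^bsub>mloc M S\<^esub> w = 0"
    unfolding z using assms by (subst lc_mfrac) (auto simp: fc_def ext_zero)
qed

lemma mloc_add:
  assumes S: "S \<subseteq> {..<d}" and X: "X \<in> carrier (mloc M S)" and Y: "Y \<in> carrier (mloc M S)"
  shows "X \<oplus>\<^bsub>mloc M S\<^esub> Y \<in> carrier (mloc M S)"
    "lc S (X \<oplus>\<^bsub>mloc M S\<^esub> Y) w = lc S X w + lc S Y w"
proof -
  have fin: "finite S" using S finite_subset by blast
  obtain p k q l where p: "keys p \<subseteq> E" "X = mfrac (vprod S) M p k"
    and q: "keys q \<subseteq> E" "Y = mfrac (vprod S) M q l"
    using X Y unfolding mloc_carrier by blast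
  let ?Z = "\<lambda>p k q l. mfrac (vprod S) M (vprod S ^ l * p + vprod S ^ k * q) (k + l)"
  have E: "keys (vprod S ^ l * p + vprod S ^ k * q) \<subseteq> E" if "keys p \<subseteq> E" "keys q \<subseteq> E" for p q :: "'a mpoly" and k l
    using that S by (intro keys_add_subset carrier_vprod_mult)
  \<comment> \<open>Operations on fractions are defined as unions over all representatives. As the
    result is the same for each of them, the union collapses to a single fraction; the same device
    serves for signs and for \<open>loc_map\<close>.\<close>
  have Z: "?Z p' k' q' l' = ?Z p k q l" if "(p', k') \<in> X" "(q', l') \<in> Y" for p' k' q' l'
  proof -
    have *: "keys p' \<subseteq> E" "fc S p' k' = fc S p k" "keys q' \<subseteq> E" "fc S q' l' = fc S q l"
      using that p q fin by (auto simp: mfrac_eq)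
    show ?thesis
      using fin E p q * by (subst mfrac_eq_iff) (auto simp: fc_sum_fractions fun_eq_iff)
  qed
  have "X \<oplus>\<^bsub>mloc M S\<^esub> Y = (\<Union>(p', k')\<in>X. \<Union>(q', l')\<in>Y. ?Z p' k' q' l')"
    by (simp add: mloc_def localization_def)
  also have "\<dots> = (\<Union>(p', k')\<in>X. \<Union>(q', l')\<in>Y. ?Z p k q l)"
    using Z by fastforce
  also have "\<dots> = ?Z p k q l"
    using p q fin by (auto simp: mfrac_eq)
  finally have e: "X \<oplus>\<^bsub>mloc M S\<^esub> Y = ?Z p k q l" .
  show "X \<oplus>\<^bsub>mloc M S\<^esub> Y \<in> carrier (mloc M S)"
    unfolding e mloc_carrier using E p q by blast
  show "lc S (X \<oplus>\<^bsub>mloc M S\<^esub> Y) w = lc S X w + lc S Y w"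
    unfolding e using p q fin E by (simp add: lc_mfrac fc_sum_fractions)
qed

lemma mloc_sign:
  assumes S: "finite S" and X: "X \<in> carrier (mloc M S)"
  shows "(- 1) ^ n \<odot>\<^bsub>mloc M S\<^esub> X \<in> carrier (mloc M S)"
    "lc S ((- 1) ^ n \<odot>\<^bsub>mloc M S\<^esub> X) w = (- 1) ^ n * lc S X w"
proof -
  obtain p k where p: "keys p \<subseteq> E" "X = mfrac (vprod S) M p k"
    using X unfolding mloc_carrier by blast
  let ?Z = "\<lambda>p k. mfrac (vprod S) M ((- 1) ^ n * p) k"
  have Z: "?Z p' k' = ?Z p k" if "(p', k') \<in> X" for p' k'
  proof -
    have *: "keys p' \<subseteq> E" "fc S p' k' = fc S p k"
      using that p S by (auto simp: mfrac_eq)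
    show ?thesis
      using *(2) unfolding mfrac_eq_iff[OF S carrier_sign[OF *(1)] carrier_sign[OF p(1)]]
      by (simp add: fc_def ext_sign fun_eq_iff)
  qed
  have "(- 1) ^ n \<odot>\<^bsub>mloc M S\<^esub> X = (\<Union>(p', k')\<in>X. ?Z p' k')"
    by (simp add: mloc_def localization_def)
  also have "\<dots> = (\<Union>(p', k')\<in>X. ?Z p k)"
    using Z by fastforce
  also have "\<dots> = ?Z p k"
    using p S by (auto simp: mfrac_eq)
  finally have e: "(- 1) ^ n \<odot>\<^bsub>mloc M S\<^esub> X = ?Z p k" .
  show "(- 1) ^ n \<odot>\<^bsub>mloc M S\<^esub> X \<in> carrier (mloc M S)"
    unfolding e mloc_carrier using carrier_sign p by blast
  show "lc S ((- 1) ^ n \<odot>\<^bsub>mloc M S\<^esub> X) w = (- 1) ^ n * lc S X w"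
    unfolding e lc_mfrac[OF S carrier_sign[OF p(1)]] unfolding p(2) lc_mfrac[OF S p(1)]
    by (simp add: fc_def ext_sign)
qed

text \<open>Numerator and denominator are both multiplied by the k-th power of the variable j, so
  the map is an inclusion of Laurent polynomials and leaves all coefficients unchanged.\<close>

lemma mloc_loc_map:
  assumes S: "S \<subseteq> {..<d}" and j: "j \<in> S" and X: "X \<in> carrier (mloc M (S - {j}))"
  shows "loc_map (vprod (S - {j})) (mvar j) M X \<in> carrier (mloc M S)"
    "lc S (loc_map (vprod (S - {j})) (mvar j) M X) w = lc (S - {j}) X w"
proof -
  have fin: "finite S" "finite (S - {j})" using S finite_subset by blast+
  obtain p k where p: "keys p \<subseteq> E" "X = mfrac (vprod (S - {j})) M p k"
    using X unfolding mloc_carrier by blast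
  have f: "vprod (S - {j}) * mvar j = (vprod S :: 'a mpoly)"
    unfolding vprod_def using fin j by (simp add: prod.remove mult.commute)
  have mj: "mvar j ^ k = (vprod {j} ^ k :: 'a mpoly)" for k by (simp add: vprod_def)
  have E: "keys (mvar j ^ k * p) \<subseteq> E" if "keys p \<subseteq> E" for k and p :: "'a mpoly"
    unfolding mj using that S j by (intro carrier_vprod_mult) auto
  have fc: "fc S (mvar j ^ k * p) k = fc (S - {j}) p k" for k and p :: "'a mpoly"
  proof
    fix w
    have "shift {j} (- int k) (shift S (int k) w) = shift (S - {j}) (int k) w"
      using j by (auto simp: shift_def fun_eq_iff)
    then show "fc S (mvar j ^ k * p) k w = fc (S - {j}) p k w"
      unfolding mj fc_def by (subst ext_vprod_power_mult) auto
  qed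
  let ?Z = "\<lambda>p k. mfrac (vprod S) M (mvar j ^ k * p) k"
  have Z: "?Z p' k' = ?Z p k" if "(p', k') \<in> X" for p' k'
  proof -
    have *: "keys p' \<subseteq> E" "fc (S - {j}) p' k' = fc (S - {j}) p k"
      using that p fin by (auto simp: mfrac_eq)
    show ?thesis
      using fin p(1) * E by (subst mfrac_eq_iff) (auto simp: fc)
  qed
  have "loc_map (vprod (S - {j})) (mvar j) M X = (\<Union>(p', k')\<in>X. ?Z p' k')"
    by (simp add: loc_map_def f)
  also have "\<dots> = (\<Union>(p', k')\<in>X. ?Z p k)"
    using Z by fastforce
  also have "\<dots> = ?Z p k"
    using p fin by (auto simp: mfrac_eq)
  finally have e: "loc_map (vprod (S - {j})) (mvar j) M X = ?Z p k" .
  show "loc_map (vprod (S - {j})) (mvar j) M X \<in> carrier (mloc M S)"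
    unfolding e mloc_carrier using E p by blast
  show "lc S (loc_map (vprod (S - {j})) (mvar j) M X) w = lc (S - {j}) X w"
    unfolding e using p fin E by (simp add: lc_mfrac fc)
qed

lemma mloc_abelian_monoid:
  assumes S: "S \<subseteq> {..<d}" shows "abelian_monoid (mloc M S :: ('k::field mpoly, _) gmodule)"
proof -
  have fin: "finite S" using S finite_subset by blast
  note [simp] = mloc_add[OF S] mloc_zero[OF fin]
  show ?thesis
    by (rule abelian_monoidI) (simp, simp, (rule lc_eqI[OF fin]; simp add: fun_eq_iff)+)
qed

lemma mloc_finsum:
  assumes S: "S \<subseteq> {..<d}" and "finite J" "\<And>j. j \<in> J \<Longrightarrow> f j \<in> carrier (mloc M S)"
  shows "finsum (mloc M S) f J \<in> carrier (mloc M S) \<and>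
    lc S (finsum (mloc M S) f J) w = (\<Sum>j\<in>J. lc S (f j) w)"
  using assms(2,3)
proof (induction J rule: finite_induct)
  have fin: "finite S" using S finite_subset by blast
  interpret abelian_monoid "mloc M S" by (rule mloc_abelian_monoid[OF S])
  case empty
  then show ?case using mloc_zero[OF fin] by simp
next
  interpret abelian_monoid "mloc M S" by (rule mloc_abelian_monoid[OF S])
  case (insert x F)
  then have "finsum (mloc M S) f (insert x F) = f x \<oplus>\<^bsub>mloc M S\<^esub> finsum (mloc M S) f F"
    by (intro finsum_insert) auto
  moreover have "f x \<in> carrier (mloc M S)" "finsum (mloc M S) f F \<in> carrier (mloc M S)"
    "lc S (finsum (mloc M S) f F) w = (\<Sum>j\<in>F. lc S (f j) w)"
    using insert by auto
  ultimately show ?case using insert.hyps mloc_add[OF S, of "f x" "finsum (mloc M S) f F"] by simp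
qed

text \<open>For a fixed exponent w this is the simplicial coboundary of the scalar function S
  \<mapsto> coefficient at w, to which the later vanishing arguments reduce.\<close>

lemma cech_d_lc:
  assumes S: "S \<in> isets d (Suc i)" and c: "\<And>T. T \<in> isets d i \<Longrightarrow> c T \<in> carrier (mloc M T)"
  shows "cech_d d M i c S \<in> carrier (mloc M S)"
    "lc S (cech_d d M i c S) w = (\<Sum>j\<in>S. (- 1) ^ card {s\<in>S. s < j} * lc (S - {j}) (c (S - {j})) w)"
proof -
  have Sd: "S \<subseteq> {..<d}" using S by (simp add: isets_def)
  then have fin: "finite S" using finite_subset by blast
  have T: "S - {j} \<in> isets d i" if "j \<in> S" for j
    using S that fin by (auto simp: isets_def)
  let ?f = "\<lambda>j. (- 1) ^ card {s\<in>S. s < j} \<odot>\<^bsub>mloc M S\<^esub> loc_map (vprod (S - {j})) (mvar j) M (c (S - {j}))"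
  have f: "?f j \<in> carrier (mloc M S)" 
    "lc S (?f j) w = (- 1) ^ card {s\<in>S. s < j} * lc (S - {j}) (c (S - {j})) w" if "j \<in> S" for j
    using mloc_sign[OF fin mloc_loc_map(1)[OF Sd that c[OF T[OF that]]]]
      mloc_loc_map(2)[OF Sd that c[OF T[OF that]]] by simp_all
  have "cech_d d M i c S = finsum (mloc M S) ?f S"
    using S by (simp add: cech_d_def)
  then show "cech_d d M i c S \<in> carrier (mloc M S)"
    "lc S (cech_d d M i c S) w = (\<Sum>j\<in>S. (- 1) ^ card {s\<in>S. s < j} * lc (S - {j}) (c (S - {j})) w)"
    using mloc_finsum[OF Sd fin, of ?f w] f by simp_all
qed

text \<open>\<open>w\<close> is an exponent of degree \<open>r\<close> of the localization of the ideal at \<open>\<Prod>i\<in>S. x\<^sub>i\<close>.\<close>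

definition adm :: "nat set \<Rightarrow> int \<Rightarrow> (nat \<Rightarrow> int) \<Rightarrow> bool" where
  "adm S r w \<longleftrightarrow> (\<forall>i\<ge>d. w i = 0) \<and> (\<Sum>i<d. w i) = r \<and> (\<exists>N. shift S (int N) w \<in> vecz ` E)"

lemma sum_shift:
  "S \<subseteq> {..<d} \<Longrightarrow> (\<Sum>i<d. shift S k w i) = (\<Sum>i<d. w i) + k * int (card S)"
proof -
  assume "S \<subseteq> {..<d}"
  then have "{..<d} \<inter> S = S" by auto
  then show ?thesis by (simp add: shift_def sum.distrib sum.If_cases)
qed

lemma int_total: "u \<in> nvecs d \<Longrightarrow> int (total u) = (\<Sum>i<d. vecz u i)"
  by (simp add: total_eq_sum vecz_def)

lemma hcomp_mloc:
  "hcomp (mloc M S) r = {mfrac (vprod S) M p k | p k. keys p \<subseteq> E \<and> (\<forall>u\<in>keys p. int (total u) = r + int (k * card S))}"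
  by (auto simp: mloc_def localization_def)

lemma hcomp_carrier: "X \<in> hcomp (mloc M S) r \<Longrightarrow> X \<in> carrier (mloc M S)"
  by (auto simp: hcomp_mloc mloc_carrier)

lemma lc_hcomp:
  assumes S: "S \<subseteq> {..<d}" and X: "X \<in> hcomp (mloc M S) r"
  shows "finite {w. lc S X w \<noteq> 0}" "lc S X w \<noteq> 0 \<Longrightarrow> adm S r w"
proof -
  have fin: "finite S" using S finite_subset by blast
  obtain p k where p: "keys p \<subseteq> E" "\<forall>u\<in>keys p. int (total u) = r + int (k * card S)"
    "X = mfrac (vprod S) M p k"
    using X unfolding hcomp_mloc by blast
  have lc: "lc S X = fc S p k" using p fin by (simp add: lc_mfrac)
  have *: "\<exists>u\<in>keys p. shift S (int k) w = vecz u" if "lc S X w \<noteq> 0" for w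
  proof (rule ccontr)
    assume n: "\<not> ?thesis"
    have "ext p (shift S (int k) w) = 0"
      unfolding ext_def using n by (intro sum.neutral) force
    then show False using that by (simp add: lc fc_def)
  qed
  have "{w. lc S X w \<noteq> 0} \<subseteq> (\<lambda>u. shift S (- int k) (vecz u)) ` keys p"
  proof
    fix w assume "w \<in> {w. lc S X w \<noteq> 0}"
    then obtain u where "u \<in> keys p" "shift S (int k) w = vecz u" using * by blast
    then show "w \<in> (\<lambda>u. shift S (- int k) (vecz u)) ` keys p"
      by (intro image_eqI[of _ _ u]) (auto simp: shift_shift simp flip: \<open>shift S (int k) w = vecz u\<close>)
  qed
  then show "finite {w. lc S X w \<noteq> 0}" by (rule finite_subset) simp
  assume "lc S X w \<noteq> 0"
  then obtain u where u: "u \<in> keys p" "shift S (int k) w = vecz u" using * by blast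
  then have un: "u \<in> E" "u \<in> nvecs d" using p E_nvecs by auto
  have "w i = 0" if "i \<ge> d" for i
  proof -
    have "vecz u i = 0" using un that by (simp add: vecz_def nvecs_iff)
    moreover have "i \<notin> S" using S that by auto
    ultimately show ?thesis by (simp add: shift_def flip: u(2))
  qed
  moreover have "(\<Sum>i<d. w i) = r"
  proof -
    have "int (total u) = (\<Sum>i<d. shift S (int k) w i)" using int_total[OF un(2)] u(2) by simp
    also have "\<dots> = (\<Sum>i<d. w i) + int k * int (card S)" by (rule sum_shift[OF S])
    finally show ?thesis using p(2) u(1) by simp
  qed
  ultimately show "adm S r w" unfolding adm_def using u un by blast
qed

lemma shift_mono_E:
  assumes "S \<subseteq> {..<d}" "shift S (int k) w \<in> vecz ` E" "k \<le> l"
  shows "shift S (int l) w \<in> vecz ` E"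
proof -
  have fin: "finite S" using assms finite_subset by blast
  obtain u where u: "u \<in> E" "shift S (int k) w = vecz u" using assms by blast
  have "shift S (int l) w = shift S (int (l - k)) (shift S (int k) w)"
    using assms by (simp add: shift_shift)
  also have "\<dots> = vecz (u + pw S (l - k))"
    unfolding u(2) using fin by (auto simp: vecz_def shift_def lookup_add lookup_pw fun_eq_iff)
  finally show ?thesis using E_up u pw_nvecs assms by blast
qed

text \<open>Converse of \<open>lc_hcomp\<close>: finite support permits a common denominator.
  Together they identify the homogeneous component of degree r with the finitely supported functions
  on admissible exponents.\<close>

lemma ex_lc:
  assumes S: "S \<subseteq> {..<d}" and fw: "finite {w. g w \<noteq> 0}" and adm: "\<And>w. g w \<noteq> 0 \<Longrightarrow> adm S r w"
  shows "\<exists>X\<in>hcomp (mloc M S) r. lc S X = (g :: _ \<Rightarrow> 'k::field)"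
proof -
  have fin: "finite S" using S finite_subset by blast
  let ?W = "{w. g w \<noteq> 0}"
  obtain n where n: "\<And>w. g w \<noteq> 0 \<Longrightarrow> shift S (int (n w)) w \<in> vecz ` E"
  proof -
    have "\<forall>w. \<exists>N. g w \<noteq> 0 \<longrightarrow> shift S (int N) w \<in> vecz ` E"
      using adm unfolding adm_def by blast
    then show ?thesis using that by metis
  qed
  \<comment> \<open>The sum dominates every \<open>n w\<close> on the finite support and needs no
    special treatment of the empty one.\<close>
  define N where "N = sum n ?W"
  have "shift S (int N) w \<in> vecz ` E" if "g w \<noteq> 0" for w
    using n[OF that] that fw by (intro shift_mono_E[OF S n]) (auto simp: N_def intro: member_le_sum)
  then have "\<forall>w. \<exists>u. g w \<noteq> 0 \<longrightarrow> u \<in> E \<and> shift S (int N) w = vecz u" by blast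
  then obtain e where e: "\<And>w. g w \<noteq> 0 \<Longrightarrow> e w \<in> E" "\<And>w. g w \<noteq> 0 \<Longrightarrow> shift S (int N) w = vecz (e w)"
    by metis
  define p where "p = (\<Sum>w\<in>?W. single (e w) (g w))"
  have kp: "keys p \<subseteq> e ` ?W"
    unfolding p_def using keys_sum[of "\<lambda>w. single (e w) (g w)" ?W] by (auto split: if_splits)
  then have pE: "keys p \<subseteq> E" using e(1) by auto
  have "fc S p N w = g w" for w
  proof -
    have "fc S p N w = (\<Sum>w'\<in>?W. if vecz (e w') = shift S (int N) w then g w' else 0)"
      by (simp add: fc_def p_def ext_sum ext_single)
    also have "\<dots> = (\<Sum>w'\<in>?W. if w' = w then g w' else 0)"
      by (intro sum.cong) (auto simp: shift_inj simp flip: e(2))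
    also have "\<dots> = g w" using fw by simp
    finally show ?thesis .
  qed
  then have "lc S (mfrac (vprod S) M p N) = g"
    using fin pE by (simp add: lc_mfrac fun_eq_iff)
  moreover have "int (total u) = r + int (N * card S)" if "u \<in> keys p" for u
  proof -
    obtain w where w: "g w \<noteq> 0" "u = e w" using kp \<open>u \<in> keys p\<close> by blast
    then have "int (total u) = (\<Sum>i<d. shift S (int N) w i)"
      using e E_nvecs int_total by force
    also have "\<dots> = r + int (N * card S)"
      using adm[OF w(1)] by (simp add: sum_shift[OF S] adm_def)
    finally show ?thesis .
  qed
  then have "mfrac (vprod S) M p N \<in> hcomp (mloc M S) r"
    unfolding hcomp_mloc using pE by blast
  ultimately show ?thesis by blast
qed

end

section \<open>The Cech complex of a monomial ideal\<close>

text \<open>Passing between the two orders of removing l and inserting j changes exactly one of the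
  two counts, by one: the first if j < l, the second if l < j.\<close>

lemma sign_swap:
  fixes j l :: nat
  assumes "finite S" "j \<notin> S" "l \<in> S"
  shows "(- 1) ^ card {s\<in>S. s < l} * (- 1) ^ card {s\<in>insert j (S - {l}). s < j}
    = - ((- 1) ^ card {s\<in>insert j S. s < j} * (- 1) ^ card {s\<in>insert j S. s < l} :: 'k::comm_ring_1)"
proof -
  have 1: "card {s\<in>insert j S. s < l} = card {s\<in>S. s < l} + (if j < l then 1 else 0)"
  proof -
    have "{s\<in>insert j S. s < l} = (if j < l then insert j {s\<in>S. s < l} else {s\<in>S. s < l})"
      by auto
    then show ?thesis using assms by simp
  qed
  have 2: "card {s\<in>insert j S. s < j} = card {s\<in>insert j (S - {l}). s < j} + (if l < j then 1 else 0)"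
  proof -
    have "{s\<in>insert j S. s < j} = (if l < j then insert l {s\<in>insert j (S - {l}). s < j}
      else {s\<in>insert j (S - {l}). s < j})"
      using assms by auto
    then show ?thesis using assms by simp
  qed
  have "j \<noteq> l" using assms by auto
  then show ?thesis unfolding 1 2 by (cases "j < l") (auto simp: power_add)
qed

text \<open>The function b is the contraction of c towards the apex j. For j outside S, the value
  \<open>c S\<close> occurs in the cocycle condition at \<open>insert j S\<close>, and solving for
  it gives the coboundary of b.\<close>

lemma cone_homotopy:
  fixes c :: "nat set \<Rightarrow> 'k::comm_ring_1"
  assumes cocycle: "\<And>S. S \<in> isets d (Suc i) \<Longrightarrow> (\<Sum>l\<in>S. (- 1) ^ card {s\<in>S. s < l} * c (S - {l})) = 0"
    and j: "j < d"
    and b: "\<And>T. b T = (if j \<in> T then 0 else (- 1) ^ card {s\<in>insert j T. s < j} * c (insert j T))"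
    and S: "S \<in> isets d i"
  shows "(\<Sum>l\<in>S. (- 1) ^ card {s\<in>S. s < l} * b (S - {l})) = c S"
proof -
  have fin: "finite S" using S finite_subset by (auto simp: isets_def)
  let ?sg = "\<lambda>l S. (- 1) ^ card {s\<in>S. s < (l::nat)} :: 'k"
  show ?thesis
  proof (cases "j \<in> S")
    case True
    \<comment> \<open>All terms with l other than j vanish, since b is 0 on sets containing
      j.\<close>
    then have "(\<Sum>l\<in>S. ?sg l S * b (S - {l})) = ?sg j S * b (S - {j})"
      using fin b by (subst sum.remove[of S j]) (auto intro!: sum.neutral)
    also have "\<dots> = (?sg j S * ?sg j S) * c S"
      using True by (simp add: b insert_absorb)
    also have "?sg j S * ?sg j S = 1"
      by (simp flip: power_mult_distrib)
    finally show ?thesis by simp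
  next
    case False
    let ?S = "insert j S"
    have "?S \<in> isets d (Suc i)" using S j False fin by (auto simp: isets_def)
    then have "0 = (\<Sum>l\<in>?S. ?sg l ?S * c (?S - {l}))" by (rule cocycle[symmetric])
    also have "\<dots> = ?sg j ?S * c S + (\<Sum>l\<in>S. ?sg l ?S * c (?S - {l}))"
      using fin False by simp
    \<comment> \<open>The extra sign squares to 1 and frees \<open>c S\<close> of its
      coefficient.\<close>
    finally have "?sg j ?S * (?sg j ?S * c S + (\<Sum>l\<in>S. ?sg l ?S * c (?S - {l}))) = 0"
      by simp
    then have "c S = - (\<Sum>l\<in>S. ?sg j ?S * ?sg l ?S * c (?S - {l}))"
      unfolding eq_neg_iff_add_eq_0
      by (simp add: distrib_left sum_distrib_left mult.assoc flip: mult.assoc[of "?sg j ?S" "?sg j ?S"] power_mult_distrib)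
    moreover have "(\<Sum>l\<in>S. ?sg l S * b (S - {l})) = (\<Sum>l\<in>S. - (?sg j ?S * ?sg l ?S * c (?S - {l})))"
    proof (rule sum.cong[OF refl])
      fix l assume l: "l \<in> S"
      then have "?S - {l} = insert j (S - {l})" using False by auto
      then show "?sg l S * b (S - {l}) = - (?sg j ?S * ?sg l ?S * c (?S - {l}))"
        using sign_swap[OF fin False l, where 'k = 'k] False
        by (simp add: b mult.assoc[symmetric])
    qed
    ultimately show ?thesis unfolding sum_negf by (rule trans[OF _ sym, rotated])
  qed
qed

section \<open>From scalar cone contractions to vanishing of local cohomology\<close>

context monomial_ideal
begin

lemma cech_carrier: "carrier (cech d M i r) = (\<Pi>\<^sub>E S\<in>isets d i. hcomp (mloc M S) r)"
  by (simp add: cech_def)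

lemma cech_one: "\<one>\<^bsub>cech d M i r\<^esub> = (\<lambda>S\<in>isets d i. \<zero>\<^bsub>mloc M S\<^esub>)"
  by (simp add: cech_def)

lemma cech_mult: "x \<otimes>\<^bsub>cech d M i r\<^esub> y = (\<lambda>S\<in>isets d i. x S \<oplus>\<^bsub>mloc M S\<^esub> y S)"
  by (simp add: cech_def)

lemma isets_subset: "S \<in> isets d i \<Longrightarrow> S \<subseteq> {..<d}" "S \<in> isets d i \<Longrightarrow> finite S"
  using finite_subset by (auto simp: isets_def)

lemma cech_mem_carrier:
  "x \<in> carrier (cech d M i r) \<Longrightarrow> S \<in> isets d i \<Longrightarrow> x S \<in> carrier (mloc M S)"
  using hcomp_carrier by (auto simp: cech_carrier PiE_iff)

lemma ex_cochain:
  fixes g :: "nat set \<Rightarrow> (nat \<Rightarrow> int) \<Rightarrow> 'k::field"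
  assumes "\<And>S. S \<in> isets d i \<Longrightarrow> finite {w. g S w \<noteq> 0}"
    and "\<And>S w. S \<in> isets d i \<Longrightarrow> g S w \<noteq> 0 \<Longrightarrow> adm S r w"
  obtains t where "t \<in> carrier (cech d M i r)" "\<And>S. S \<in> isets d i \<Longrightarrow> lc S (t S) = g S"
proof -
  have "\<forall>S. \<exists>X. S \<in> isets d i \<longrightarrow> X \<in> hcomp (mloc M S) r \<and> lc S X = g S"
    using ex_lc[OF isets_subset(1) assms] by blast
  then obtain X where "\<And>S. S \<in> isets d i \<Longrightarrow> X S \<in> hcomp (mloc M S) r \<and> lc S (X S) = g S"
    by metis
  then show ?thesis by (intro that[of "\<lambda>S\<in>isets d i. X S"]) (auto simp: cech_carrier)
qed

lemma lc_cochain: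
  assumes "x \<in> carrier (cech d M i r)" "S \<in> isets d i"
  shows "finite {w. lc S (x S) w \<noteq> 0}" "lc S (x S) w \<noteq> 0 \<Longrightarrow> adm S r w"
  using assms lc_hcomp[OF isets_subset(1)[OF assms(2)], of "x S" r] by (auto simp: cech_carrier PiE_iff)

lemma cech_d_eqI:
  assumes "y \<in> carrier (cech d M i r)" "x \<in> extensional (isets d (Suc i))"
    and "\<And>S. S \<in> isets d (Suc i) \<Longrightarrow> x S \<in> carrier (mloc M S)"
    and "\<And>S w. S \<in> isets d (Suc i) \<Longrightarrow>
      (\<Sum>j\<in>S. (- 1) ^ card {s\<in>S. s < j} * lc (S - {j}) (y (S - {j})) w) = lc S (x S) w"
  shows "cech_d d M i y = x"
proof (rule extensionalityI[of _ "isets d (Suc i)"])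
  fix S assume S: "S \<in> isets d (Suc i)"
  note y = cech_mem_carrier[OF assms(1)]
  show "cech_d d M i y S = x S"
  proof (rule lc_eqI[OF isets_subset(2)[OF S] cech_d_lc(1)[OF S y] assms(3)[OF S]])
    show "lc S (cech_d d M i y S) = lc S (x S)"
      using cech_d_lc(2)[OF S y] assms(4)[OF S] by (simp add: fun_eq_iff)
  qed
qed (use assms in \<open>auto simp: cech_d_def\<close>)

lemma cech_d_combine:
  fixes y z :: "nat set \<Rightarrow> ('k::field mpoly \<times> nat) set"
  assumes y: "y \<in> carrier (cech d M i r)" and z: "z \<in> carrier (cech d M i r)"
  obtains t where "t \<in> carrier (cech d M i r)"
    "\<And>S. S \<in> isets d i \<Longrightarrow> lc S (t S) = (\<lambda>w. lc S (z S) w + e * lc S (y S) w)"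
proof -
  have fin: "finite {w. lc S (z S) w + e * lc S (y S) w \<noteq> 0}" if S: "S \<in> isets d i" for S
    by (rule finite_subset[OF _ finite_UnI[OF lc_cochain(1)[OF z S] lc_cochain(1)[OF y S]]]) auto
  have adm: "adm S r w" if S: "S \<in> isets d i" and nz: "lc S (z S) w + e * lc S (y S) w \<noteq> 0" for S w
    using nz lc_cochain(2)[OF z S, of w] lc_cochain(2)[OF y S, of w]
    by (cases "lc S (z S) w = 0") auto
  show ?thesis
    by (rule ex_cochain[of i "\<lambda>S w. lc S (z S) w + e * lc S (y S) w" r, OF _ _ that]) (use fin adm in auto)
qed

text \<open>The image of the differential absorbs adding and subtracting \<open>D y\<close>. This is
  verified on Laurent coefficients and stands in for group axioms of \<open>cech\<close> in positive
  cohomological degree.\<close>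

lemma coboundary_coset:
  fixes y :: "nat set \<Rightarrow> ('k::field mpoly \<times> nat) set"
  assumes y: "y \<in> carrier (cech d M i r)"
  defines "D \<equiv> cech_d d M i"
  shows "(\<lambda>z. D z \<otimes>\<^bsub>cech d M (Suc i) r\<^esub> D y) ` carrier (cech d M i r) = D ` carrier (cech d M i r)"
    (is "?L = ?R")
proof -
  have sum: "D t = D z \<otimes>\<^bsub>cech d M (Suc i) r\<^esub> D y"
    if t: "t \<in> carrier (cech d M i r)" and z: "z \<in> carrier (cech d M i r)"
      and e: "\<And>S. S \<in> isets d i \<Longrightarrow> lc S (t S) = (\<lambda>w. lc S (z S) w + lc S (y S) w)" for t z
    unfolding D_def
  proof (rule cech_d_eqI[OF t])
    fix S assume S: "S \<in> isets d (Suc i)"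
    note dy = cech_d_lc[OF S cech_mem_carrier[OF y]] and dz = cech_d_lc[OF S cech_mem_carrier[OF z]]
    have S': "S - {j} \<in> isets d i" if "j \<in> S" for j
      using S that isets_subset(2)[OF S] by (auto simp: isets_def)
    show "(cech_d d M i z \<otimes>\<^bsub>cech d M (Suc i) r\<^esub> cech_d d M i y) S \<in> carrier (mloc M S)"
      using mloc_add(1)[OF isets_subset(1)[OF S] dz(1) dy(1)] S by (simp add: cech_mult)
    show "(\<Sum>j\<in>S. (- 1) ^ card {s\<in>S. s < j} * lc (S - {j}) (t (S - {j})) w)
      = lc S ((cech_d d M i z \<otimes>\<^bsub>cech d M (Suc i) r\<^esub> cech_d d M i y) S) w" for w
      using mloc_add(2)[OF isets_subset(1)[OF S] dz(1) dy(1)] S dy(2) dz(2)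
      by (simp add: cech_mult e[OF S'] distrib_left sum.distrib)
  qed (simp add: cech_mult)
  show ?thesis
  proof
    show "?L \<subseteq> ?R"
    proof
      fix x assume "x \<in> ?L"
      then obtain z where z: "z \<in> carrier (cech d M i r)" "x = D z \<otimes>\<^bsub>cech d M (Suc i) r\<^esub> D y" by blast
      obtain t where "t \<in> carrier (cech d M i r)"
        "\<And>S. S \<in> isets d i \<Longrightarrow> lc S (t S) = (\<lambda>w. lc S (z S) w + 1 * lc S (y S) w)"
        using cech_d_combine[OF y z(1)] by blast
      then show "x \<in> ?R" using sum[of t z] z by force
    qed
    show "?R \<subseteq> ?L"
    proof
      fix x assume "x \<in> ?R"
      then obtain z where z: "z \<in> carrier (cech d M i r)" "x = D z" by blast
      obtain t where t: "t \<in> carrier (cech d M i r)"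
        "\<And>S. S \<in> isets d i \<Longrightarrow> lc S (t S) = (\<lambda>w. lc S (z S) w + (- 1) * lc S (y S) w)"
        using cech_d_combine[OF y z(1)] by blast
      then have "D z = D t \<otimes>\<^bsub>cech d M (Suc i) r\<^esub> D y" using z by (intro sum) auto
      then show "x \<in> ?L" using z t by blast
    qed
  qed
qed

lemma cocycle_lc:
  assumes x: "x \<in> carrier (cech d M i r)" and c: "cech_d d M i x = \<one>\<^bsub>cech d M (Suc i) r\<^esub>"
    and S: "S \<in> isets d (Suc i)"
  shows "(\<Sum>j\<in>S. (- 1) ^ card {s\<in>S. s < j} * lc (S - {j}) (x (S - {j})) w) = 0"
  using cech_d_lc(2)[OF S cech_mem_carrier[OF x], of w] S
  by (simp add: c cech_one mloc_zero(2)[OF isets_subset(2)[OF S]])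

text \<open>The contraction is carried out for each exponent w with its own apex. The hypothesis
  \<open>cone\<close> ensures that the resulting primitive has only admissible exponents, so that an
  actual cochain of degree r realizes it.\<close>

lemma cocycle_imp_coboundary:
  fixes x :: "nat set \<Rightarrow> ('k::field mpoly \<times> nat) set"
  assumes cone: "\<And>w. \<exists>j<d. \<forall>T\<in>isets d i. j \<notin> T \<longrightarrow> adm (insert j T) r w \<longrightarrow> adm T r w"
    and x: "x \<in> carrier (cech d M (Suc i) r)"
    and c: "cech_d d M (Suc i) x = \<one>\<^bsub>cech d M (Suc (Suc i)) r\<^esub>"
  shows "x \<in> cech_d d M i ` carrier (cech d M i r)"
proof -
  obtain j where j: "\<And>w. j w < d"
    "\<And>w T. T \<in> isets d i \<Longrightarrow> j w \<notin> T \<Longrightarrow> adm (insert (j w) T) r w \<Longrightarrow> adm T r w"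
    using cone by metis
  define g where "g = (\<lambda>T w. if j w \<in> T then 0
    else (- 1) ^ card {s\<in>insert (j w) T. s < j w} * lc (insert (j w) T) (x (insert (j w) T)) w)"
  have ins: "insert (j w) T \<in> isets d (Suc i)" if "T \<in> isets d i" "j w \<notin> T" for T w
    using that j(1)[of w] isets_subset(2)[OF that(1)] by (auto simp: isets_def)
  obtain y where y: "y \<in> carrier (cech d M i r)" "\<And>T. T \<in> isets d i \<Longrightarrow> lc T (y T) = g T"
  proof (rule ex_cochain[of i g r])
    fix T assume T: "T \<in> isets d i"
    have nz: "j w \<notin> T \<and> lc (insert (j w) T) (x (insert (j w) T)) w \<noteq> 0" if "g T w \<noteq> 0" for w
      using that by (auto simp: g_def split: if_splits)
    show "finite {w. g T w \<noteq> 0}"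
    proof (rule finite_subset)
      \<comment> \<open>Although the apex varies with w, it takes only finitely many values l < d,
        and each of them accounts for a finite support.\<close>
      show "{w. g T w \<noteq> 0} \<subseteq> (\<Union>l\<in>{..<d} - T. {w. lc (insert l T) (x (insert l T)) w \<noteq> 0})"
        using nz j(1) by blast
      show "finite (\<Union>l\<in>{..<d} - T. {w. lc (insert l T) (x (insert l T)) w \<noteq> 0})"
      proof (intro finite_UN_I)
        fix l assume "l \<in> {..<d} - T"
        then have "insert l T \<in> isets d (Suc i)" using T isets_subset(2)[OF T] by (auto simp: isets_def)
        then show "finite {w. lc (insert l T) (x (insert l T)) w \<noteq> 0}" by (rule lc_cochain(1)[OF x])
      qed auto
    qed
    show "adm T r w" if "g T w \<noteq> 0" for w
      using nz[OF that] j(2)[OF T] lc_cochain(2)[OF x ins[OF T]] by blast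
  qed blast
  have "cech_d d M i y = x"
  proof (rule cech_d_eqI[OF y(1)])
    fix S w assume S: "S \<in> isets d (Suc i)"
    have S': "S - {l} \<in> isets d i" if "l \<in> S" for l
      using S that isets_subset(2)[OF S] by (auto simp: isets_def)
    have "(\<Sum>l\<in>S. (- 1) ^ card {s\<in>S. s < l} * lc (S - {l}) (y (S - {l})) w)
      = (\<Sum>l\<in>S. (- 1) ^ card {s\<in>S. s < l} * g (S - {l}) w)"
      by (intro sum.cong) (simp_all add: y(2)[OF S'])
    also have "\<dots> = lc S (x S) w"
      by (rule cone_homotopy[OF cocycle_lc[OF x c] j(1)[of w] _ S, where b = "\<lambda>T. g T w"])
        (simp_all add: g_def)
    finally show "(\<Sum>l\<in>S. (- 1) ^ card {s\<in>S. s < l} * lc (S - {l}) (y (S - {l})) w) = lc S (x S) w" .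
  qed (use x cech_mem_carrier[OF x] in \<open>auto simp: cech_carrier PiE_iff\<close>)
  then show ?thesis using y by blast
qed

text \<open>Provides a cocycle, so that the set of cosets forming the quotient is not empty.\<close>

lemma zero_cochain:
  obtains z :: "nat set \<Rightarrow> ('k::field mpoly \<times> nat) set"
  where "z \<in> carrier (cech d M i r)" "cech_d d M i z = \<one>\<^bsub>cech d M (Suc i) r\<^esub>"
proof -
  obtain z :: "nat set \<Rightarrow> ('k mpoly \<times> nat) set"
    where z: "z \<in> carrier (cech d M i r)" "\<And>S. S \<in> isets d i \<Longrightarrow> lc S (z S) = (\<lambda>_. 0)"
    by (rule ex_cochain[of i "\<lambda>_ _. 0" r]) auto
  have "cech_d d M i z = \<one>\<^bsub>cech d M (Suc i) r\<^esub>"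
  proof (rule cech_d_eqI[OF z(1)])
    fix S w assume S: "S \<in> isets d (Suc i)"
    have S': "S - {l} \<in> isets d i" if "l \<in> S" for l
      using S that isets_subset(2)[OF S] by (auto simp: isets_def)
    show "(\<Sum>j\<in>S. (- 1) ^ card {s\<in>S. s < j} * lc (S - {j}) (z (S - {j})) w)
      = lc S (\<one>\<^bsub>cech d M (Suc i) r\<^esub> S) w"
      using S by (simp add: z(2)[OF S'] cech_one mloc_zero(2)[OF isets_subset(2)[OF S]])
  qed (auto simp: cech_one mloc_zero isets_subset)
  then show ?thesis using that z by blast
qed

text \<open>The elements of the quotient are the cosets of \<open>coboundaries\<close> by cocycles,
  and its unit is \<open>coboundaries\<close> itself; so it suffices that every such coset is equal
  to \<open>coboundaries\<close>.\<close>

lemma local_cohomology_trivialI: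
  fixes r :: int
  assumes "\<And>x. x \<in> kernel (cech d M i r) (cech d M (Suc i) r) (cech_d d M i) \<Longrightarrow>
    (\<lambda>h. h \<otimes>\<^bsub>cech d M i r\<^esub> x) ` coboundaries d M i r = coboundaries d (M :: ('k::field mpoly, 'k mpoly) gmodule) i r"
  shows "carrier (local_cohomology d (M :: ('k mpoly, 'k mpoly) gmodule) i r)
    = {\<one>\<^bsub>local_cohomology d (M :: ('k mpoly, 'k mpoly) gmodule) i r\<^esub>}"
proof -
  let ?M = "M :: ('k mpoly, 'k mpoly) gmodule"
  let ?K = "kernel (cech d ?M i r) (cech d ?M (Suc i) r) (cech_d d ?M i)"
  let ?H = "coboundaries d ?M i r"
  have "?H #>\<^bsub>(cech d ?M i r)\<lparr>carrier := ?K\<rparr>\<^esub> x = (\<lambda>h. h \<otimes>\<^bsub>cech d ?M i r\<^esub> x) ` ?H" for x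
    by (auto simp: r_coset_def)
  then have "carrier (local_cohomology d ?M i r) = (\<Union>x\<in>?K. {(\<lambda>h. h \<otimes>\<^bsub>cech d ?M i r\<^esub> x) ` ?H})"
    by (simp add: local_cohomology_def FactGroup_def RCOSETS_def)
  also have "\<dots> = (\<Union>x\<in>?K. {?H})"
    using assms by auto
  also have "\<dots> = {?H}"
  proof -
    obtain z where "z \<in> ?K"
      using zero_cochain[of i r, where 'k = 'k] by (auto simp: kernel_def)
    then show ?thesis by auto
  qed
  finally show ?thesis by (simp add: local_cohomology_def FactGroup_def)
qed

lemma local_cohomology_0:
  assumes "d \<ge> 1"
  shows "carrier (local_cohomology d (M :: ('k::field mpoly, 'k mpoly) gmodule) 0 r)
    = {\<one>\<^bsub>local_cohomology d (M :: ('k mpoly, 'k mpoly) gmodule) 0 r\<^esub>}"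
proof (rule local_cohomology_trivialI)
  fix x :: "nat set \<Rightarrow> ('k mpoly \<times> nat) set"
  assume "x \<in> kernel (cech d M 0 r) (cech d M (Suc 0) r) (cech_d d M 0)"
  then have x: "x \<in> carrier (cech d M 0 r)" "cech_d d M 0 x = \<one>\<^bsub>cech d M (Suc 0) r\<^esub>"
    by (auto simp: kernel_def)
  have "S = {}" if "S \<in> isets d 0" for S
    using isets_subset(2)[OF that] that by (simp add: isets_def)
  moreover have "{} \<in> isets d 0" by (simp add: isets_def)
  ultimately have i0: "isets d 0 = {{}}" by blast
  have "{0} \<in> isets d (Suc 0)" using assms by (simp add: isets_def)
  \<comment> \<open>The component at {0} of the differential is the map from the ideal to its
    localization at the variable 0, which preserves Laurent coefficients and is hence
    injective.\<close>
  then have "lc {} (x {}) w = 0" for w using cocycle_lc[OF x, of "{0}" w] by simp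
  moreover have "x {} \<in> carrier (mloc M {})" using cech_mem_carrier[OF x(1)] i0 by simp
  ultimately have x0: "x {} = \<zero>\<^bsub>mloc M {}\<^esub>"
    by (intro lc_eqI[of "{}"]) (auto simp: fun_eq_iff mloc_zero)
  have "\<zero>\<^bsub>mloc M {}\<^esub> \<oplus>\<^bsub>mloc M {}\<^esub> \<zero>\<^bsub>mloc M {}\<^esub> = (\<zero>\<^bsub>mloc M {}\<^esub> :: ('k mpoly \<times> nat) set)"
    by (intro lc_eqI[of "{}"]) (auto simp: fun_eq_iff mloc_add mloc_zero)
  then show "(\<lambda>h. h \<otimes>\<^bsub>cech d M 0 r\<^esub> x) ` coboundaries d M 0 r = coboundaries d M 0 r"
    by (simp add: coboundaries_def cech_mult cech_one i0 x0 cong: restrict_cong)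
qed

lemma local_cohomology_Suc:
  assumes "\<And>w. \<exists>j<d. \<forall>T\<in>isets d i. j \<notin> T \<longrightarrow> adm (insert j T) r w \<longrightarrow> adm T r w"
  shows "carrier (local_cohomology d (M :: ('k::field mpoly, 'k mpoly) gmodule) (Suc i) r)
    = {\<one>\<^bsub>local_cohomology d (M :: ('k mpoly, 'k mpoly) gmodule) (Suc i) r\<^esub>}"
proof (rule local_cohomology_trivialI)
  fix x :: "nat set \<Rightarrow> ('k mpoly \<times> nat) set"
  assume "x \<in> kernel (cech d M (Suc i) r) (cech d M (Suc (Suc i)) r) (cech_d d M (Suc i))"
  then obtain y where y: "y \<in> carrier (cech d M i r)" "x = cech_d d M i y"
    using cocycle_imp_coboundary[OF assms, of x] by (auto simp: kernel_def)
  show "(\<lambda>h. h \<otimes>\<^bsub>cech d M (Suc i) r\<^esub> x) ` coboundaries d M (Suc i) r = coboundaries d M (Suc i) r"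
    using coboundary_coset[OF y(1)] by (simp add: coboundaries_def y(2) image_image)
qed

end

section \<open>Regularity of monomial ideals with two coprime generators\<close>

lemma pring_cring: "cring (pring d :: 'k::field mpoly ring)"
proof (rule cringI)
  show "abelian_group (pring d :: 'k mpoly ring)"
  proof (rule abelian_groupI)
    fix x :: "'k mpoly" assume "x \<in> carrier (pring d)"
    then show "\<exists>y\<in>carrier (pring d). y \<oplus>\<^bsub>pring d\<^esub> x = \<zero>\<^bsub>pring d\<^esub>"
      by (intro bexI[of _ "- x"]) (auto simp: pring_def)
  qed (auto simp: pring_def keys_add_subset add.assoc add.commute)
  show "comm_monoid (pring d :: 'k mpoly ring)"
    by (rule comm_monoidI)
      (auto simp: pring_def mult.assoc mult.commute keys_mult_subset[OF _ _ nvecs_add] nvecs_zero)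
qed (auto simp: pring_def distrib_right)

lemma pring_simps [simp]:
  "carrier (pring d) = {p. keys p \<subseteq> nvecs d}" "add (pring d) = (+)" "mult (pring d) = (*)"
  "zero (pring d) = 0" "one (pring d) = 1"
  by (auto simp: pring_def)

lemma pring_a_inv: "keys p \<subseteq> nvecs d \<Longrightarrow> \<ominus>\<^bsub>pring d\<^esub> p = - p"
proof -
  assume p: "keys p \<subseteq> nvecs d"
  interpret cring "pring d" by (rule pring_cring)
  show ?thesis by (rule sum_zero_eq_neg[symmetric]) (use p in auto)
qed

definition multiples :: "nat \<Rightarrow> expo set \<Rightarrow> expo set" where
  "multiples d U = {x \<in> nvecs d. \<exists>u\<in>U. \<forall>i. lookup u i \<le> lookup x i}"

lemma monomial_ideal_multiples: "monomial_ideal d (multiples d U)"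
  by unfold_locales (auto simp: multiples_def nvecs_add lookup_add intro: trans_le_add1)

lemma genideal_monomials:
  assumes U: "U \<subseteq> nvecs d"
  shows "genideal (pring d) (mmonom ` U) = {p :: 'k::field mpoly. keys p \<subseteq> multiples d U}"
proof
  interpret cring "pring d :: 'k mpoly ring" by (rule pring_cring)
  interpret E: monomial_ideal d "multiples d U" by (rule monomial_ideal_multiples)
  let ?I = "{p :: 'k mpoly. keys p \<subseteq> multiples d U}"
  let ?J = "genideal (pring d) (mmonom ` U) :: 'k mpoly set"
  have "subgroup ?I (add_monoid (pring d))"
  proof
    show "inv\<^bsub>add_monoid (pring d)\<^esub> p \<in> ?I" if "p \<in> ?I" for p
      using that E.E_nvecs pring_a_inv[of p d] by (auto simp: a_inv_def)
  qed (use E.E_nvecs in \<open>auto simp: keys_add_subset\<close>)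
  moreover have "keys (x * p) \<subseteq> multiples d U" if "keys p \<subseteq> multiples d U" "keys x \<subseteq> nvecs d" for p x :: "'k mpoly"
    by (rule keys_mult_subset[OF that(2,1)]) (metis E.E_up add.commute)
  ultimately have "ideal ?I (pring d)"
    by (intro idealI) (auto simp: mult.commute ring_axioms)
  moreover have "mmonom ` U \<subseteq> ?I"
    using U by (auto simp: mmonom_def multiples_def)
  ultimately show "?J \<subseteq> ?I" by (rule genideal_minimal)
  have gen: "ideal ?J (pring d)" and sub: "mmonom ` U \<subseteq> ?J"
    using U by (intro genideal_ideal genideal_self; auto simp: mmonom_def)+
  interpret J: ideal ?J "pring d" by (rule gen)
  show "?I \<subseteq> ?J"
  proof
    fix p :: "'k mpoly" assume p: "p \<in> ?I"
    have mon: "single x k \<in> ?J" if x: "x \<in> multiples d U" for x k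
    proof -
      obtain u where u: "u \<in> U" "\<And>i. lookup u i \<le> lookup x i" using x by (auto simp: multiples_def)
      have "x = (x - u) + u" by (rule poly_mapping_eqI) (simp add: lookup_add lookup_minus u)
      then have "single x k = single (x - u) k * mmonom u" by (simp add: mmonom_def mult_single)
      moreover have "x - u \<in> nvecs d" using x by (simp add: multiples_def nvecs_minus)
      ultimately show ?thesis using J.I_l_closed[of "mmonom u" "single (x - u) k"] sub u by auto
    qed
    have "(\<Sum>x\<in>F. single x (lookup p x)) \<in> ?J" if "finite F" "F \<subseteq> multiples d U" for F
      using that
    proof (induction F rule: finite_induct)
      case empty
      then show ?case using J.zero_closed by simp
    next
      case (insert x F)
      then show ?case using J.a_closed[OF mon] by simp
    qed
    then show "p \<in> ?J" using p mpoly_eq_sum[of p] by (metis finite_keys mem_Collect_eq)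
  qed
qed

lemma idealI_eq:
  "(idealI d \<alpha> \<Gamma> :: ('k::field mpoly, 'k mpoly) gmodule) = mono_module (multiples d ((\<lambda>x. quot_vec d \<alpha> x (hvec d \<Gamma>)) ` \<Gamma>))"
proof -
  let ?U = "(\<lambda>x. quot_vec d \<alpha> x (hvec d \<Gamma>)) ` \<Gamma>"
  have U: "?U \<subseteq> nvecs d" by (auto simp: quot_vec_def simp flip: vec_def)
  have "(\<lambda>x. mmonom (quot_vec d \<alpha> x (hvec d \<Gamma>)) :: 'k mpoly) ` \<Gamma> = mmonom ` ?U"
    by (simp add: image_image)
  then show ?thesis
    unfolding idealI_def Let_def mono_module_def by (simp only: genideal_monomials[OF U])
qed

text \<open>A cone structure on the i-element sets kills the cohomology in degree i + 1, so
  \<open>Suc i + r\<close> is the quantity maximized by \<open>reg\<close>. Cohomological degree 0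
  vanishes altogether and contributes -\<infinity>.\<close>

lemma (in monomial_ideal) reg_le:
  assumes d: "d \<ge> 1"
    and cone: "\<And>i r w. int N < int (Suc i) + r \<Longrightarrow>
      \<exists>j<d. \<forall>T\<in>isets d i. j \<notin> T \<longrightarrow> adm (insert j T) r w \<longrightarrow> adm T r w"
  shows "reg d (M :: ('k::field mpoly, 'k mpoly) gmodule) \<le> ereal (real N)"
  unfolding reg_def
proof (rule SUP_least)
  fix i :: nat
  have "a_invariant (local_cohomology d (M :: ('k mpoly, 'k mpoly) gmodule) i) \<le> ereal (real N - real i)"
    unfolding a_invariant_def
  proof (rule SUP_least)
    fix r assume "r \<in> {r. carrier (local_cohomology d (M :: ('k mpoly, 'k mpoly) gmodule) i r)
      \<noteq> {\<one>\<^bsub>local_cohomology d (M :: ('k mpoly, 'k mpoly) gmodule) i r\<^esub>}}"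
    then have nz: "carrier (local_cohomology d (M :: ('k mpoly, 'k mpoly) gmodule) i r)
      \<noteq> {\<one>\<^bsub>local_cohomology d (M :: ('k mpoly, 'k mpoly) gmodule) i r\<^esub>}" by simp
    then obtain k where k: "i = Suc k" using local_cohomology_0[OF d] by (cases i) auto
    have "\<not> int N < int (Suc k) + r" using nz local_cohomology_Suc[OF cone] unfolding k by blast
    then have "real_of_int r \<le> real_of_int (int N - int i)" unfolding k by linarith
    then show "ereal (of_int r) \<le> ereal (real N - real i)" by simp
  qed
  then have "ereal (real i) + a_invariant (local_cohomology d (M :: ('k mpoly, 'k mpoly) gmodule) i)
    \<le> ereal (real i) + ereal (real N - real i)"
    by (rule add_left_mono)
  then show "ereal (real i) + a_invariant (local_cohomology d (M :: ('k mpoly, 'k mpoly) gmodule) i) \<le> ereal (real N)"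
    by simp
qed

text \<open>Inverting the variables in S removes the constraints on the coordinates in S, as these
  can be raised arbitrarily; the other coordinates are not moved by the shift.\<close>

lemma adm_multiples_iff:
  assumes S: "S \<subseteq> {..<d}" and U: "U \<subseteq> nvecs d"
  shows "monomial_ideal.adm d (multiples d U) S r w \<longleftrightarrow>
    (\<forall>i\<ge>d. w i = 0) \<and> (\<Sum>i<d. w i) = r \<and> (\<exists>u\<in>U. \<forall>i<d. i \<notin> S \<longrightarrow> int (lookup u i) \<le> w i)"
proof -
  interpret monomial_ideal d "multiples d U" by (rule monomial_ideal_multiples)
  have "(\<exists>N. shift S (int N) w \<in> vecz ` multiples d U) \<longleftrightarrow> (\<exists>u\<in>U. \<forall>i<d. i \<notin> S \<longrightarrow> int (lookup u i) \<le> w i)"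
    (is "?L \<longleftrightarrow> ?R") if w: "\<forall>i\<ge>d. w i = 0"
  proof
    assume ?L
    then obtain N x u where x: "shift S (int N) w = vecz x" "u \<in> U" "\<And>i. lookup u i \<le> lookup x i"
      by (auto simp: multiples_def)
    have "int (lookup u i) \<le> w i" if "i \<notin> S" for i
      using fun_cong[OF x(1), of i] x(3)[of i] that by (simp add: shift_def vecz_def)
    then show ?R using x(2) by blast
  next
    assume ?R
    then obtain u where u: "u \<in> U" "\<And>i. i < d \<Longrightarrow> i \<notin> S \<Longrightarrow> int (lookup u i) \<le> w i" by blast
    \<comment> \<open>The first summand outweighs a negative coordinate of w, the second lifts it to
      that of u.\<close>
    define N where "N = (\<Sum>i<d. nat \<bar>w i\<bar>) + total u"
    have N: "int (lookup u i) \<le> w i + int N" if "i < d" for i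
    proof -
      have "nat \<bar>w i\<bar> \<le> (\<Sum>i<d. nat \<bar>w i\<bar>)" using that by (intro member_le_sum) auto
      then show ?thesis using lookup_le_total[of u i] unfolding N_def by linarith
    qed
    have ge: "int (lookup u i) \<le> shift S (int N) w i" for i
    proof (cases "i < d")
      case True
      then show ?thesis using N u by (simp add: shift_def)
    next
      case False
      moreover have "lookup u i = 0" using False u U by (auto simp: nvecs_iff)
      moreover have "i \<notin> S" using False S by auto
      ultimately show ?thesis using w by (simp add: shift_def)
    qed
    define x where "x = vec d (\<lambda>i. nat (shift S (int N) w i))"
    have "shift S (int N) w = vecz x"
    proof
      fix i
      have "shift S (int N) w i \<ge> 0" using ge[of i] by linarith
      moreover have "shift S (int N) w i = 0" if "\<not> i < d" using that w S by (auto simp: shift_def)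
      ultimately show "shift S (int N) w i = vecz x i" by (simp add: x_def vecz_def)
    qed
    moreover have "lookup u i \<le> lookup x i" for i
      using fun_cong[OF \<open>shift S (int N) w = vecz x\<close>, of i] ge[of i] by (simp add: vecz_def)
    moreover have "x \<in> nvecs d" by (simp add: x_def)
    ultimately have "x \<in> multiples d U" "shift S (int N) w = vecz x"
      using u(1) unfolding multiples_def by blast+
    then show ?L by blast
  qed
  then show ?thesis unfolding adm_def by blast
qed

text \<open>
  In degree \<open>w\<close> the Cech complex is supported on the sets containing \<open>{i. w\<^sub>i < u\<^sub>i}\<close> or
  \<open>{i. w\<^sub>i < v\<^sub>i}\<close>; this is a cone with apex any \<open>j\<close> outside both. If there is no such \<open>j\<close>,
  then \<open>w\<^sub>i < u\<^sub>i + v\<^sub>i\<close> for all \<open>i\<close>, and only the top cohomological degree remains to be treated.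
\<close>

lemma reg_two_generated_le:
  assumes d: "d \<ge> 1" and uv: "u \<in> nvecs d" "v \<in> nvecs d"
    and disj: "\<And>i. min (lookup u i) (lookup v i) = 0"
  shows "reg d (mono_module (multiples d {u, v}) :: ('k::field mpoly, 'k mpoly) gmodule)
    \<le> ereal (real (total u + total v - 1))"
proof -
  interpret monomial_ideal d "multiples d {u, v}" by (rule monomial_ideal_multiples)
  show ?thesis
  proof (rule reg_le[OF d])
    fix i :: nat and r :: int and w :: "nat \<Rightarrow> int"
    assume bound: "int (total u + total v - 1) < int (Suc i) + r"
    let ?above = "\<lambda>T. (\<forall>j<d. j \<notin> T \<longrightarrow> int (lookup u j) \<le> w j) \<or> (\<forall>j<d. j \<notin> T \<longrightarrow> int (lookup v j) \<le> w j)"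
    have adm: "adm T r w \<longleftrightarrow> (\<forall>i\<ge>d. w i = 0) \<and> (\<Sum>i<d. w i) = r \<and> ?above T" if "T \<subseteq> {..<d}" for T
      using adm_multiples_iff[OF that, of "{u, v}"] uv by simp
    have T: "T \<subseteq> {..<d}" "card T = i" if "T \<in> isets d i" for T using that by (auto simp: isets_def)
    consider (cone) j where "j < d" "int (lookup u j) \<le> w j" "int (lookup v j) \<le> w j"
      | (deg) "(\<Sum>i<d. w i) \<noteq> r"
      | (big) "i \<ge> d"
      | (top) "(\<Sum>i<d. w i) = r" "i < d" "\<And>j. j < d \<Longrightarrow> w j < int (lookup u j) \<or> w j < int (lookup v j)"
      by (meson not_le)
    then show "\<exists>j<d. \<forall>T\<in>isets d i. j \<notin> T \<longrightarrow> adm (insert j T) r w \<longrightarrow> adm T r w"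
    proof cases
      case cone
      have "adm T r w" if "T \<in> isets d i" "adm (insert j T) r w" for T
      proof -
        have sub: "T \<subseteq> {..<d}" "insert j T \<subseteq> {..<d}" using T(1)[OF that(1)] cone(1) by auto
        have "?above T" if "?above (insert j T)" using that cone by blast
        then show ?thesis using that(2) unfolding adm[OF sub(1)] adm[OF sub(2)] by blast
      qed
      then show ?thesis using cone(1) by blast
    next
      case deg
      then show ?thesis using d by (intro exI[of _ 0]) (auto simp: adm_def)
    next
      case big
      \<comment> \<open>In this range T can only be the full index set, so no T avoids 0 and the
        condition for j = 0 is vacuous.\<close>
      have "0 \<in> T" if "T \<in> isets d i" for T
      proof -
        have "T = {..<d}" using T[OF that] big by (intro card_seteq) auto
        then show ?thesis using d by simp
      qed
      then show ?thesis using d by (intro exI[of _ 0]) auto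
    next
      case top
      have "w j \<le> int (lookup u j) + int (lookup v j) - 1" if "j < d" for j
        using top(3)[OF that] by linarith
      then have "(\<Sum>j<d. w j) \<le> (\<Sum>j<d. int (lookup u j) + int (lookup v j) - 1)"
        by (intro sum_mono) auto
      also have "\<dots> = int (total u) + int (total v) - int d"
        using uv by (simp add: total_eq_sum[of _ d] sum.distrib sum_subtractf)
      \<comment> \<open>The sum gives r \<le> |u| + |v| - d, and \<open>bound\<close> gives r > |u|
        + |v| - 2 - i; hence i > d - 2.\<close>
      finally have i: "i = d - 1" using bound top(1,2) by linarith
      have "\<exists>j<d. int (lookup u j) \<le> w j \<or> int (lookup v j) \<le> w j"
      proof (rule ccontr)
        assume "\<not> ?thesis"
        \<comment> \<open>Coprimality enters: w j is below both exponents, one of which is 0.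
          Summing yields r \<le> -d, so i + 1 + r \<le> 0, which \<open>bound\<close>
          excludes.\<close>
        then have "w j \<le> - 1" if "j < d" for j
          using disj[of j] that by (cases "lookup u j = 0") (auto simp: min_def not_le split: if_splits)
        then have "(\<Sum>j<d. w j) \<le> (\<Sum>j<d. - 1)" by (intro sum_mono) auto
        then show False using bound top(1) i d by simp
      qed
      then obtain j where j: "j < d" "int (lookup u j) \<le> w j \<or> int (lookup v j) \<le> w j" by blast
      have "adm T r w" if "T \<in> isets d i" "j \<notin> T" "adm (insert j T) r w" for T
      proof -
        \<comment> \<open>Having d - 1 elements and missing j, T leaves only the coordinate j
          constrained, and there w j is large enough for u or for v.\<close>
        have "T = {..<d} - {j}" using T[OF that(1)] that(2) i j(1) by (intro card_seteq) auto
        then have "?above T" using j by auto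
        then show ?thesis using that(3) T[OF that(1)] adm j(1) by (simp add: adm)
      qed
      then show ?thesis using j(1) by blast
    qed
  qed
qed

section \<open>The semigroup ring\<close>

context simplicial_semigroup
begin

abbreviation K :: "('k::field mpoly, 'k mpoly) gmodule" where "K \<equiv> KB d \<alpha> c a"

lemma single_eq_mconst_mult: "single x k = mconst k * mmonom x"
  by (simp add: mconst_def mmonom_def mult_single)

lemma generate_ring_B:
  "generate_ring (pring d) (range mconst \<union> mmonom ` B) = {p :: 'k::field mpoly. keys p \<subseteq> B}"
proof
  let ?G = "generate_ring (pring d) (range mconst \<union> mmonom ` B) :: 'k mpoly set"
  show "?G \<subseteq> {p. keys p \<subseteq> B}"
  proof
    fix p assume "p \<in> ?G"
    then have "keys p \<subseteq> B"
    proof induction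
      case (a_inv h)
      then have "keys h \<subseteq> nvecs d" using B_nvecs by blast
      then show ?case using a_inv pring_a_inv[of h d] by simp
    next
      case (eng_mult h1 h2)
      then show ?case using keys_mult_subset[of h1 B h2 B B] B_add by simp
    qed (auto simp: mconst_def mmonom_def B_zero keys_add_subset split: if_splits)
    then show "p \<in> {p. keys p \<subseteq> B}" by simp
  qed
  show "{p. keys p \<subseteq> B} \<subseteq> ?G"
  proof
    fix p :: "'k mpoly" assume p: "p \<in> {p. keys p \<subseteq> B}"
    have mon: "single x k \<in> ?G" if "x \<in> B" for x k
      using generate_ring.eng_mult[of "mconst k" "pring d" "range mconst \<union> mmonom ` B" "mmonom x"] that
      by (simp add: single_eq_mconst_mult generate_ring.incl)
    have "(\<Sum>x\<in>F. single x (lookup p x)) \<in> ?G" if "finite F" "F \<subseteq> B" for F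
      using that
    proof (induction F rule: finite_induct)
      case empty
      then show ?case using mon[OF B_zero, of 0] by simp
    next
      case (insert x F)
      then show ?case using generate_ring.eng_add[OF mon, of x] by simp
    qed
    from this[of "keys p"] p show "p \<in> ?G" by (simp flip: mpoly_eq_sum)
  qed
qed

lemma KB_simps [simp]:
  "carrier K = {p. keys p \<subseteq> B}" "add K = (+)" "mult K = (*)" "zero K = 0" "one K = 1"
  "hcomp K r = {q. keys q \<subseteq> B \<and> (\<forall>b\<in>keys q. vdeg \<alpha> b = of_int r)}"
  by (auto simp: KB_def Let_def generate_ring_B)

lemma KB_cring: "cring (K :: ('k::field mpoly, 'k mpoly) gmodule)"
proof (rule cringI)
  show "abelian_group (K :: ('k mpoly, 'k mpoly) gmodule)"
  proof (rule abelian_groupI)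
    fix x :: "'k mpoly" assume "x \<in> carrier K"
    then show "\<exists>y\<in>carrier K. y \<oplus>\<^bsub>K\<^esub> x = \<zero>\<^bsub>K\<^esub>"
      by (intro bexI[of _ "- x"]) auto
  qed (auto simp: keys_add_subset add.assoc add.commute)
  show "comm_monoid (K :: ('k mpoly, 'k mpoly) gmodule)"
    by (rule comm_monoidI)
      (auto simp: mult.assoc mult.commute keys_mult_subset[OF _ _ B_add] B_zero)
qed (auto simp: distrib_right)

lemma KB_a_inv: "keys p \<subseteq> B \<Longrightarrow> \<ominus>\<^bsub>K\<^esub> p = - p" for p :: "'k::field mpoly"
proof -
  assume p: "keys p \<subseteq> B"
  interpret cring "K :: ('k mpoly, 'k mpoly) gmodule" by (rule KB_cring)
  show ?thesis by (rule sum_zero_eq_neg[symmetric]) (use p in auto)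
qed

text \<open>The kernel of the projection of \<open>K[B]\<close> to the face \<open>t\<^sub>j = 0\<close> for \<open>j < n\<close>.\<close>

definition face_ideal :: "nat \<Rightarrow> 'k::field mpoly set" where
  "face_ideal n = {p. keys p \<subseteq> {b \<in> B. \<exists>j<n. lookup b j \<noteq> 0}}"

text \<open>The elements of B with vanishing first n coordinates are closed under addition. After
  discarding the parts of p and q in the ideal, the product of the remainders is supported on these
  elements; if p q is in the ideal, it is also supported off them. It is therefore 0, and
  polynomials have no zero divisors.\<close>

lemma face_ideal_prime:
  assumes "n \<le> d" shows "primeideal (face_ideal n :: 'k::field mpoly set) K"
proof -
  let ?N = "{b \<in> B. \<exists>j<n. lookup b j \<noteq> 0}"
  interpret cring "K :: ('k mpoly, 'k mpoly) gmodule" by (rule KB_cring)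
  have "subgroup (face_ideal n :: 'k mpoly set) (add_monoid K)"
  proof
    show "inv\<^bsub>add_monoid K\<^esub> p \<in> face_ideal n" if "p \<in> face_ideal n" for p :: "'k mpoly"
    proof -
      have "keys p \<subseteq> B" using that by (auto simp: face_ideal_def)
      then have "inv\<^bsub>add_monoid K\<^esub> p = - p" using KB_a_inv[of p] by (simp only: a_inv_def)
      then show ?thesis using that by (simp add: face_ideal_def)
    qed
  qed (auto simp: face_ideal_def keys_add_subset)
  moreover have mult: "x * p \<in> face_ideal n" if "p \<in> face_ideal n" "keys x \<subseteq> B" for p x :: "'k mpoly"
    using keys_mult_subset[OF that(2), of p ?N ?N] that(1) B_add by (auto simp: face_ideal_def lookup_add)
  ultimately have ideal: "ideal (face_ideal n :: 'k mpoly set) K"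
    by (intro Ideal.idealI) (auto simp: mult.commute ring_axioms)
  have split: "\<exists>p' p''. p = p' + p'' \<and> keys p' \<subseteq> B - ?N \<and> p'' \<in> face_ideal n" if "keys p \<subseteq> B" for p :: "'k mpoly"
  proof (intro exI conjI)
    let ?p = "\<lambda>S. \<Sum>x\<in>keys p \<inter> S. single x (lookup p x)"
    have "p = (\<Sum>x\<in>(keys p \<inter> - ?N) \<union> (keys p \<inter> ?N). single x (lookup p x))"
      using mpoly_eq_sum[of p] by (simp flip: Int_Un_distrib)
    also have "\<dots> = ?p (- ?N) + ?p ?N"
      by (rule sum.union_disjoint) auto
    finally show "p = ?p (- ?N) + ?p ?N" .
    have k: "keys (?p S) \<subseteq> keys p \<inter> S" for S
      using keys_sum[of "\<lambda>x. single x (lookup p x)" "keys p \<inter> S"] by (auto split: if_splits)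
    show "keys (?p (- ?N)) \<subseteq> B - ?N" using k[of "- ?N"] that by blast
    show "?p ?N \<in> face_ideal n" using k[of ?N] by (auto simp: face_ideal_def)
  qed
  show ?thesis
  proof (rule primeidealI[OF ideal])
    show "cring (K :: ('k mpoly, 'k mpoly) gmodule)" by (rule KB_cring)
    have "(1 :: 'k mpoly) \<notin> face_ideal n" by (simp add: face_ideal_def)
    then show "carrier K \<noteq> (face_ideal n :: 'k mpoly set)" using B_zero by auto
    fix p q :: "'k mpoly"
    assume "p \<in> carrier K" "q \<in> carrier K" and pq: "p \<otimes>\<^bsub>K\<^esub> q \<in> face_ideal n"
    then have B: "keys p \<subseteq> B" "keys q \<subseteq> B" by auto
    obtain p' p'' where p: "p = p' + p''" "keys p' \<subseteq> B - ?N" "p'' \<in> face_ideal n" using split[OF B(1)] by blast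
    obtain q' q'' where q: "q = q' + q''" "keys q' \<subseteq> B - ?N" "q'' \<in> face_ideal n" using split[OF B(2)] by blast
    have "keys (p * q) \<subseteq> ?N" using pq by (simp add: face_ideal_def)
    moreover have "keys (q * p'') \<subseteq> ?N" "keys (p' * q'') \<subseteq> ?N"
      using mult[OF p(3) B(2)] mult[OF q(3), of p'] p(2) by (auto simp: face_ideal_def)
    moreover have "p' * q' = p * q + (- (q * p'') + - (p' * q''))"
      by (simp add: p(1) q(1) algebra_simps)
    ultimately have "keys (p' * q') \<subseteq> ?N" by (simp only: keys_add_subset keys_uminus)
    moreover have "keys (p' * q') \<subseteq> - ?N"
      by (rule keys_mult_subset[OF p(2) q(2)]) (auto simp: lookup_add)
    ultimately have "keys (p' * q') = {}" by blast
    then have "p' * q' = 0" by (intro poly_mapping_eqI) (auto simp: in_keys_iff)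
    then have "p' = 0 \<or> q' = 0" by simp
    then show "p \<in> face_ideal n \<or> q \<in> face_ideal n" using p q by auto
  qed
qed

lemma face_ideal_strict: "n < d \<Longrightarrow> face_ideal n \<subset> (face_ideal (Suc n) :: 'k::field mpoly set)"
proof
  show "face_ideal n \<subseteq> (face_ideal (Suc n) :: 'k mpoly set)"
  proof
    fix p :: "'k mpoly" assume "p \<in> face_ideal n"
    then have "keys p \<subseteq> {b \<in> B. \<exists>j<n. lookup b j \<noteq> 0}" by (simp add: face_ideal_def)
    also have "\<dots> \<subseteq> {b \<in> B. \<exists>j<Suc n. lookup b j \<noteq> 0}" using less_SucI by blast
    finally show "p \<in> face_ideal (Suc n)" by (simp add: face_ideal_def)
  qed
  assume n: "n < d"
  have "single n \<alpha> \<in> B" using gens_in_B[of n] n by (simp add: gens_def)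
  then have "(mmonom (single n \<alpha>) :: 'k mpoly) \<in> face_ideal (Suc n)"
    using \<alpha>_pos by (auto simp: mmonom_def face_ideal_def)
  moreover have "(mmonom (single n \<alpha>) :: 'k mpoly) \<notin> face_ideal n"
    by (auto simp: mmonom_def face_ideal_def lookup_single when_def)
  ultimately show "face_ideal n \<noteq> (face_ideal (Suc n) :: 'k mpoly set)" by blast
qed

lemma krull_dim_KB: "ereal (real d) \<le> krull_dim (K :: ('k::field mpoly, 'k mpoly) gmodule)"
  unfolding krull_dim_def
proof (rule SUP_upper)
  show "d \<in> {n. \<exists>P. (\<forall>i\<le>n. primeideal (P i) (K :: ('k mpoly, 'k mpoly) gmodule)) \<and> (\<forall>i<n. P i \<subset> P (Suc i))}"
    using face_ideal_prime face_ideal_strict by (auto intro!: exI[of _ face_ideal])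
qed

section \<open>The Hilbert function and the codimension\<close>

lemma mconst_vector_space: "vector_space (\<lambda>k p. mconst k * (p :: 'k::field mpoly))"
  by unfold_locales (auto simp: mconst_def single_add distrib_left distrib_right mult_single mult.assoc[symmetric])

definition B_deg :: "nat \<Rightarrow> expo set" where
  "B_deg r = {b \<in> B. total b = \<alpha> * r}"

lemma hilbert_fun_KB: "hilbert_fun (K :: ('k::field mpoly, 'k mpoly) gmodule) (int r) = card (B_deg r)"
proof -
  interpret vector_space "\<lambda>k p. mconst k * (p :: 'k mpoly)" by (rule mconst_vector_space)
  let ?S = "mmonom ` B_deg r :: 'k mpoly set"
  have inj: "inj (mmonom :: expo \<Rightarrow> 'k mpoly)"
    unfolding mmonom_def by (auto intro!: injI simp: poly_mapping_eq_iff fun_eq_iff lookup_single when_def split: if_splits)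
      (metis zero_neq_one)
  have deg: "vdeg \<alpha> b = real r \<longleftrightarrow> total b = \<alpha> * r" for b
    using \<alpha>_pos by (simp add: vdeg_def field_simps flip: of_nat_mult)
  have "hcomp (K :: ('k mpoly, 'k mpoly) gmodule) (int r) = {p. keys p \<subseteq> B_deg r}"
    using deg by (auto simp: B_deg_def)
  also have "\<dots> = span ?S"
  proof
    show "{p. keys p \<subseteq> B_deg r} \<subseteq> span ?S"
    proof
      fix p :: "'k mpoly" assume p: "p \<in> {p. keys p \<subseteq> B_deg r}"
      have "(\<Sum>x\<in>keys p. mconst (lookup p x) * mmonom x) \<in> span ?S"
        using p by (intro span_sum span_scale span_base) auto
      then show "p \<in> span ?S" using mpoly_eq_sum[of p] by (simp add: single_eq_mconst_mult)
    qed
    show "span ?S \<subseteq> {p. keys p \<subseteq> B_deg r}"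
    proof (rule span_minimal)
      show "subspace {p :: 'k mpoly. keys p \<subseteq> B_deg r}"
        unfolding subspace_def
      proof (intro conjI ballI allI)
        fix k and p :: "'k mpoly" assume "p \<in> {p. keys p \<subseteq> B_deg r}"
        then have "keys (mconst k * p) \<subseteq> B_deg r"
          by (intro keys_mult_subset[of _ "{0}" _ "B_deg r"]) (auto simp: mconst_def)
        then show "mconst k * p \<in> {p. keys p \<subseteq> B_deg r}" by simp
      qed (auto simp: keys_add_subset)
    qed (auto simp: mmonom_def)
  qed
  finally have hc: "hcomp (K :: ('k mpoly, 'k mpoly) gmodule) (int r) = span ?S" .
  have "independent ?S"
    unfolding independent_explicit_finite_subsets
  proof (intro allI impI ballI)
    fix A :: "'k mpoly set" and u v
    assume A: "A \<subseteq> ?S" "finite A" "(\<Sum>v\<in>A. mconst (u v) * v) = 0" and v: "v \<in> A"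
    then obtain b where b: "v = mmonom b" by blast
    have "0 = (\<Sum>v\<in>A. lookup (mconst (u v) * v) b)"
      using A(3) by (simp flip: lookup_sum)
    also have "\<dots> = (\<Sum>x\<in>A. if x = v then u v else 0)"
    proof (rule sum.cong[OF refl])
      fix x assume "x \<in> A"
      then obtain b' where b': "x = mmonom b'" using A(1) by blast
      show "lookup (mconst (u x) * x) b = (if x = v then u v else 0)"
        using inj_eq[OF inj, of b' b] by (auto simp: b b' lookup_single when_def simp flip: single_eq_mconst_mult)
    qed
    also have "\<dots> = u v" using v A(2) by simp
    finally show "u v = 0" by simp
  qed
  then have "dim (span ?S) = card ?S" by (simp add: dim_eq_card_independent)
  also have "\<dots> = card (B_deg r)" by (rule card_image) (use inj in \<open>auto intro: inj_on_subset\<close>)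
  finally show ?thesis by (simp add: hilbert_fun_def hc del: KB_simps)
qed

lemma card_B_deg_1: "card (B_deg 1) \<le> d + c"
proof -
  have "B_deg 1 \<subseteq> gens d \<alpha> a ` {..<d + c}"
  proof
    fix x assume x: "x \<in> B_deg 1"
    then have "x \<noteq> 0" using \<alpha>_pos by (auto simp: B_deg_def)
    then obtain y i where y: "y \<in> B" "i < d + c" "x = y + gens d \<alpha> a i"
      using x submonoid_of_last[of x "gens d \<alpha> a ` {..<d + c}"] by (auto simp: B_deg_def semiB_def)
    then have "total y = 0" using x by (simp add: B_deg_def total_add total_gens)
    then show "x \<in> gens d \<alpha> a ` {..<d + c}" using y by (simp add: total_eq_0_iff)
  qed
  then have "card (B_deg 1) \<le> card (gens d \<alpha> a ` {..<d + c})" by (intro card_mono) auto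
  also have "\<dots> \<le> d + c" using card_image_le[of "{..<d + c}" "gens d \<alpha> a"] by simp
  finally show ?thesis .
qed

text \<open>The codimension is subtracted in the theorem, so an upper bound is enough; it results
  from \<open>card_B_deg_1\<close> and the lower bound for the dimension, without excluding infinite
  dimension.\<close>

lemma codim_KB_le: "codim (K :: ('k::field mpoly, 'k mpoly) gmodule) \<le> ereal (real c)"
proof -
  let ?D = "krull_dim (K :: ('k mpoly, 'k mpoly) gmodule)"
  have "hilbert_fun (K :: ('k mpoly, 'k mpoly) gmodule) 1 = card (B_deg 1)"
    using hilbert_fun_KB[of 1, where 'k = 'k] by simp
  then have "ereal (real (hilbert_fun (K :: ('k mpoly, 'k mpoly) gmodule) 1)) - ?D \<le> ereal (real (d + c)) - ereal (real d)"
    using card_B_deg_1 krull_dim_KB[where 'k = 'k] by (intro ereal_minus_mono) auto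
  then show ?thesis by (simp add: codim_def)
qed

end

section \<open>The Hilbert polynomial\<close>

lemma card_nvecs_total:
  assumes "d \<ge> 1"
  shows "card {w \<in> nvecs d. total w = m} = (m + (d - 1)) choose (d - 1)"
proof -
  have "bij_betw (\<lambda>w. map (lookup w) [0..<d]) {w \<in> nvecs d. total w = m} {l. length l = d \<and> sum_list l = m}"
  proof (rule bij_betwI[where g = "\<lambda>l. vec d ((!) l)"])
    show "(\<lambda>w. map (lookup w) [0..<d]) \<in> {w \<in> nvecs d. total w = m} \<rightarrow> {l. length l = d \<and> sum_list l = m}"
      by (auto simp: total_eq_sum[of _ d] interv_sum_list_conv_sum_set_nat atLeast0LessThan)
    show "(\<lambda>l. vec d ((!) l)) \<in> {l. length l = d \<and> sum_list l = m} \<rightarrow> {w \<in> nvecs d. total w = m}"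
      by (auto simp: sum_list_sum_nth atLeast0LessThan)
    show "vec d ((!) (map (lookup w) [0..<d])) = w" if "w \<in> {w \<in> nvecs d. total w = m}" for w
      using that by (intro poly_mapping_eqI) (auto simp: nvecs_iff)
    show "map (lookup (vec d ((!) l))) [0..<d] = l" if "l \<in> {l. length l = d \<and> sum_list l = m}" for l
      using that by (intro nth_equalityI) auto
  qed
  then have "card {w \<in> nvecs d. total w = m} = (m + d - 1) choose m"
    using card_length_sum_list[of d m] by (simp add: bij_betw_same_card)
  also have "\<dots> = (m + (d - 1)) choose (d - 1)"
    using assms binomial_symmetric[of m "m + d - 1"] by simp
  finally show ?thesis .
qed

text \<open>The degree is only bounded by k and the coefficient at k is prescribed, possibly as 0.
  Thus L behaves linearly under sums and differences even when leading terms cancel.\<close>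

definition eventually_poly :: "nat \<Rightarrow> real \<Rightarrow> (nat \<Rightarrow> nat) \<Rightarrow> bool" where
  "eventually_poly k L f \<longleftrightarrow> (\<exists>p. degree p \<le> k \<and> Polynomial.coeff p k = L \<and>
     (\<exists>r0. \<forall>r\<ge>r0. poly p (real r) = real (f r)))"

lemma eventually_poly_add:
  assumes "eventually_poly k L f" "eventually_poly k L' g"
  shows "eventually_poly k (L + L') (\<lambda>r. f r + g r)"
proof -
  obtain p q r1 r2 where "degree p \<le> k" "Polynomial.coeff p k = L" "\<forall>r\<ge>r1. poly p (real r) = real (f r)"
    "degree q \<le> k" "Polynomial.coeff q k = L'" "\<forall>r\<ge>r2. poly q (real r) = real (g r)"
    using assms unfolding eventually_poly_def by blast
  then show ?thesis unfolding eventually_poly_def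
    by (intro exI[of _ "p + q"]) (auto intro!: degree_add_le exI[of _ "max r1 r2"])
qed

lemma eventually_poly_diff:
  assumes "eventually_poly k L f" "eventually_poly k L' g" "\<And>r. h r + g r = f r"
  shows "eventually_poly k (L - L') h"
proof -
  obtain p q r1 r2 where "degree p \<le> k" "Polynomial.coeff p k = L" "\<forall>r\<ge>r1. poly p (real r) = real (f r)"
    "degree q \<le> k" "Polynomial.coeff q k = L'" "\<forall>r\<ge>r2. poly q (real r) = real (g r)"
    using assms(1,2) unfolding eventually_poly_def by blast
  then show ?thesis unfolding eventually_poly_def
    by (intro exI[of _ "p - q"]) (auto intro!: degree_diff_le exI[of _ "max r1 r2"] simp flip: assms(3))
qed

lemma eventually_poly_sum:
  assumes "finite I" "\<And>i. i \<in> I \<Longrightarrow> eventually_poly k L (f i)"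
  shows "eventually_poly k (real (card I) * L) (\<lambda>r. \<Sum>i\<in>I. f i r)"
  using assms
proof (induction I rule: finite_induct)
  case empty
  then show ?case unfolding eventually_poly_def by (auto intro!: exI[of _ 0])
next
  case (insert x F)
  have "eventually_poly k (L + real (card F) * L) (\<lambda>r. f x r + (\<Sum>i\<in>F. f i r))"
    by (rule eventually_poly_add) (use insert in auto)
  moreover have "L + real (card F) * L = real (card (insert x F)) * L"
    by (simp add: insert.hyps algebra_simps)
  ultimately show ?case by (simp add: insert.hyps)
qed

lemma eventually_poly_binomial:
  assumes "\<And>r. r \<ge> q \<Longrightarrow> f r = (r - q + k) choose k"
  shows "eventually_poly k (1 / fact k) f"
proof -
  \<comment> \<open>The numerator of the binomial coefficient: k! times (r - q + k choose k) is the
    product of the factors r - q + 1 + i for i < k.\<close>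
  define P :: "real poly" where "P = (\<Prod>i<k. [:1 + real i - real q, 1:])"
  have P: "degree P = k" "lead_coeff P = 1"
    unfolding P_def by (subst degree_prod_eq_sum_degree; simp) (simp add: lead_coeff_prod)
  have "poly (Polynomial.smult (1 / fact k) P) (real r) = real (f r)" if "r \<ge> q" for r
  proof -
    have "real (f r) = real (r - q + k) gchoose k"
      using assms[OF that] by (simp add: binomial_gbinomial)
    also have "\<dots> = pochhammer (real (r - q) + 1) k / fact k"
      by (simp add: gbinomial_pochhammer')
    also have "pochhammer (real (r - q) + 1) k = poly P (real r)"
      using that by (simp add: pochhammer_prod P_def poly_prod atLeast0LessThan of_nat_diff algebra_simps)
    finally show ?thesis by simp
  qed
  then show ?thesis unfolding eventually_poly_def using P
    by (intro exI[of _ "Polynomial.smult (1 / fact k) P"]) auto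
qed

lemma eventually_poly_unique:
  fixes p q :: "real poly"
  assumes "\<forall>r\<ge>r1. poly p (real r) = real (f r)" "\<forall>r\<ge>r2. poly q (real r) = real (f r)"
  shows "p = q"
proof (rule ccontr)
  assume "p \<noteq> q"
  then have "finite {x. poly (p - q) x = 0}" by (intro poly_roots_finite) simp
  moreover have "real ` {max r1 r2..} \<subseteq> {x. poly (p - q) x = 0}" using assms by auto
  ultimately have "finite (real ` {max r1 r2..})" by (rule rev_finite_subset)
  then show False by (simp add: finite_image_iff infinite_Ici)
qed

text \<open>The degree r part of X + A. For a class it is the exponent set, in degree r, of the
  translate h_t + \<alpha> I_t.\<close>

definition leA_upset :: "nat \<Rightarrow> nat \<Rightarrow> expo set \<Rightarrow> nat \<Rightarrow> expo set" where
  "leA_upset d \<alpha> X r = {b \<in> nvecs d. total b = \<alpha> * r \<and> (\<exists>x\<in>X. leA \<alpha> x b)}"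

context simplicial_semigroup
begin

lemma finite_leA_upset: "finite (leA_upset d \<alpha> X r)"
  by (rule finite_subset[OF _ finite_bounded_vecs[of "\<alpha> * r"]]) (auto simp: leA_upset_def)

lemma card_leA_upset_single:
  assumes x: "x \<in> nvecs d" "total x = \<alpha> * q" and r: "r \<ge> q"
  shows "card (leA_upset d \<alpha> {x} r) = (r - q + (d - 1)) choose (d - 1)"
proof -
  let ?f = "\<lambda>w. vec d (\<lambda>i. lookup x i + \<alpha> * lookup w i)"
  let ?g = "\<lambda>b. vec d (\<lambda>i. (lookup b i - lookup x i) div \<alpha>)"
  have "bij_betw ?f {w \<in> nvecs d. total w = r - q} (leA_upset d \<alpha> {x} r)"
  proof (rule bij_betwI[where g = ?g])
    have tf: "total (?f w) = total x + \<alpha> * total w" if "w \<in> nvecs d" for w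
      using that x by (simp add: total_eq_sum[of _ d] sum.distrib sum_distrib_left)
    have fg: "?f (?g b) = b" if b: "b \<in> leA_upset d \<alpha> {x} r" for b
    proof (rule poly_mapping_eqI)
      fix i
      have "lookup x i \<le> lookup b i" "lookup b i mod \<alpha> = lookup x i mod \<alpha>"
        using b by (auto simp: leA_upset_def leA_def eqmod_def)
      then have "\<alpha> dvd lookup b i - lookup x i" by (simp add: mod_eq_dvd_iff_nat)
      then show "lookup (?f (?g b)) i = lookup b i"
        using \<open>lookup x i \<le> lookup b i\<close> b by (auto simp: leA_upset_def nvecs_iff)
    qed
    show "?f \<in> {w \<in> nvecs d. total w = r - q} \<rightarrow> leA_upset d \<alpha> {x} r"
      using tf x r by (auto simp: leA_upset_def leA_def eqmod_def nvecs_iff simp flip: distrib_left)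
    show "?g \<in> leA_upset d \<alpha> {x} r \<rightarrow> {w \<in> nvecs d. total w = r - q}"
    proof
      fix b assume b: "b \<in> leA_upset d \<alpha> {x} r"
      have "total b = total x + \<alpha> * total (?g b)" using tf[of "?g b", OF vec_in_nvecs] unfolding fg[OF b] .
      then have "\<alpha> * r = \<alpha> * (q + total (?g b))" using b x by (simp add: leA_upset_def distrib_left)
      then have "total (?g b) = r - q" using \<alpha>_pos by simp
      then show "?g b \<in> {w \<in> nvecs d. total w = r - q}" by simp
    qed
    show "?g (?f w) = w" if "w \<in> {w \<in> nvecs d. total w = r - q}" for w
      using that \<alpha>_pos by (intro poly_mapping_eqI) (auto simp: nvecs_iff)
    show "?f (?g b) = b" if "b \<in> leA_upset d \<alpha> {x} r" for b by (rule fg[OF that])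
  qed
  then show ?thesis using card_nvecs_total[OF d_pos, of "r - q"] by (simp add: bij_betw_same_card)
qed

definition vmax :: "expo \<Rightarrow> expo \<Rightarrow> expo" where
  "vmax x y = vec d (\<lambda>i. max (lookup x i) (lookup y i))"

lemma vmax_leA:
  assumes "x \<in> nvecs d" "y \<in> nvecs d" "eqmod \<alpha> x y"
  shows "leA \<alpha> (vmax x y) b \<longleftrightarrow> leA \<alpha> x b \<and> leA \<alpha> y b" "leA \<alpha> x (vmax x y)"
proof -
  have l: "lookup (vmax x y) i = max (lookup x i) (lookup y i)" for i
    using assms by (auto simp: vmax_def nvecs_iff)
  have e: "eqmod \<alpha> x (vmax x y)" using assms(3) by (simp add: eqmod_def l max_def)
  have "eqmod \<alpha> (vmax x y) b \<longleftrightarrow> eqmod \<alpha> x b" "eqmod \<alpha> y b \<longleftrightarrow> eqmod \<alpha> x b"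
    using e assms(3) by (auto simp: eqmod_def)
  then show "leA \<alpha> (vmax x y) b \<longleftrightarrow> leA \<alpha> x b \<and> leA \<alpha> y b"
    unfolding leA_def l by auto
  show "leA \<alpha> x (vmax x y)" using e by (simp add: leA_def l)
qed

text \<open>
  The Hilbert function of the union is computed by inclusion-exclusion, where the intersection of
  two cones \<open>x + A\<close> and \<open>y + A\<close> is the cone with apex \<open>vmax x y\<close>.
\<close>

lemma eventually_poly_upset:
  assumes "finite X" "X \<noteq> {}" "\<And>x. x \<in> X \<Longrightarrow> x \<in> nvecs d \<and> \<alpha> dvd total x"
    and "\<And>x y. x \<in> X \<Longrightarrow> y \<in> X \<Longrightarrow> eqmod \<alpha> x y"
  shows "eventually_poly (d - 1) (1 / fact (d - 1)) (\<lambda>r. card (leA_upset d \<alpha> X r))"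
  using assms
proof (induction "card X" arbitrary: X rule: less_induct)
  case less
  note X = less.prems
  obtain x where x: "x \<in> X" using X(2) by blast
  define Y where "Y = X - {x}"
  have XY: "X = insert x Y" "x \<notin> Y" "finite Y" using x X(1) by (auto simp: Y_def)
  obtain q where "total x = \<alpha> * q" using X(3)[OF x] by (auto elim: dvdE)
  then have single: "eventually_poly (d - 1) (1 / fact (d - 1)) (\<lambda>r. card (leA_upset d \<alpha> {x} r))"
    using card_leA_upset_single[of x q] X(3)[OF x] by (intro eventually_poly_binomial[of q]) auto
  show ?case
  proof (cases "Y = {}")
    case True
    then show ?thesis using single XY by simp
  next
    case False
    have card_Y: "card Y < card X" using XY by simp
    have xy: "x \<in> nvecs d" "y \<in> nvecs d" "eqmod \<alpha> x y" if "y \<in> Y" for y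
      using X(3,4) XY that by auto
    have Y: "eventually_poly (d - 1) (1 / fact (d - 1)) (\<lambda>r. card (leA_upset d \<alpha> Y r))"
      using less.hyps[OF card_Y XY(3) False] X(3,4) XY by auto
    have Z: "eventually_poly (d - 1) (1 / fact (d - 1)) (\<lambda>r. card (leA_upset d \<alpha> (vmax x ` Y) r))"
    proof (rule less.hyps)
      show "card (vmax x ` Y) < card X" using card_image_le[OF XY(3), of "vmax x"] card_Y by simp
      fix z assume "z \<in> vmax x ` Y"
      then obtain y where y: "y \<in> Y" "z = vmax x y" by blast
      have zn: "z \<in> nvecs d" by (simp add: y vmax_def)
      obtain t where "t \<in> A" "z = x + t"
        using leA_A[OF xy(1)[OF y(1)] zn] vmax_leA(2)[OF xy[OF y(1)]] y(2) by blast
      then have "\<alpha> dvd total z"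
        using X(3)[OF x] A_subset_B B_props by (auto simp: total_add)
      then show "z \<in> nvecs d \<and> \<alpha> dvd total z" using zn by blast
    next
      fix z z' assume "z \<in> vmax x ` Y" "z' \<in> vmax x ` Y"
      then have "eqmod \<alpha> x z" "eqmod \<alpha> x z'" using vmax_leA(2)[OF xy] leA_imp_eqmod by auto
      then show "eqmod \<alpha> z z'" using eqmod_sym eqmod_trans by blast
    qed (use XY False in auto)
    \<comment> \<open>All three cones contribute the same coefficient, the intersection with a minus
      sign, so one copy remains.\<close>
    have "eventually_poly (d - 1) (1 / fact (d - 1) + 1 / fact (d - 1) - 1 / fact (d - 1))
      (\<lambda>r. card (leA_upset d \<alpha> X r))"
    proof (rule eventually_poly_diff[OF eventually_poly_add[OF single Y] Z])
      fix r
      have "leA_upset d \<alpha> X r = leA_upset d \<alpha> {x} r \<union> leA_upset d \<alpha> Y r"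
        unfolding XY(1) by (auto simp: leA_upset_def)
      moreover have "leA_upset d \<alpha> (vmax x ` Y) r = leA_upset d \<alpha> {x} r \<inter> leA_upset d \<alpha> Y r"
        using vmax_leA(1)[OF xy] unfolding leA_upset_def by auto
      ultimately show "card (leA_upset d \<alpha> X r) + card (leA_upset d \<alpha> (vmax x ` Y) r)
        = card (leA_upset d \<alpha> {x} r) + card (leA_upset d \<alpha> Y r)"
        using card_Un_Int[OF finite_leA_upset[of "{x}" r] finite_leA_upset[of Y r]] by simp
    qed
    then show ?thesis by simp
  qed
qed

lemma card_B_deg: "card (B_deg r) = (\<Sum>\<Gamma>\<in>Classes. card (leA_upset d \<alpha> \<Gamma> r))"
proof -
  have "B_deg r = (\<Union>\<Gamma>\<in>Classes. leA_upset d \<alpha> \<Gamma> r)"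
  proof
    show "B_deg r \<subseteq> (\<Union>\<Gamma>\<in>Classes. leA_upset d \<alpha> \<Gamma> r)"
    proof
      fix b assume b: "b \<in> B_deg r"
      then obtain m where m: "m \<in> B\<^sub>A" "leA \<alpha> m b" using BA_below by (auto simp: B_deg_def)
      have "b \<in> leA_upset d \<alpha> (classes_rel `` {m}) r"
        using b m by (auto simp: leA_upset_def B_deg_def B_nvecs classes_rel_iff)
      moreover have "classes_rel `` {m} \<in> Classes" using m(1) by (auto simp: classes_eq intro: quotientI)
      ultimately show "b \<in> (\<Union>\<Gamma>\<in>Classes. leA_upset d \<alpha> \<Gamma> r)" by blast
    qed
    show "(\<Union>\<Gamma>\<in>Classes. leA_upset d \<alpha> \<Gamma> r) \<subseteq> B_deg r"
    proof
      fix b assume "b \<in> (\<Union>\<Gamma>\<in>Classes. leA_upset d \<alpha> \<Gamma> r)"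
      then obtain \<Gamma> x where *: "\<Gamma> \<in> Classes" "x \<in> \<Gamma>" "leA \<alpha> x b" "b \<in> nvecs d" "total b = \<alpha> * r"
        by (auto simp: leA_upset_def)
      then have x: "x \<in> B" using classD(1) BA_in_B by blast
      then obtain z where "z \<in> A" "b = x + z" using leA_A[OF B_nvecs] * by blast
      then have "b \<in> B" using x A_subset_B B_add by blast
      then show "b \<in> B_deg r" using * by (simp add: B_deg_def)
    qed
  qed
  moreover have "card (\<Union>\<Gamma>\<in>Classes. leA_upset d \<alpha> \<Gamma> r) = (\<Sum>\<Gamma>\<in>Classes. card (leA_upset d \<alpha> \<Gamma> r))"
  proof (rule card_UN_disjoint[OF finite_classes], intro ballI finite_leA_upset, intro ballI impI)
    fix \<Gamma> \<Delta> assume c: "\<Gamma> \<in> Classes" "\<Delta> \<in> Classes" "\<Gamma> \<noteq> \<Delta>"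
    show "leA_upset d \<alpha> \<Gamma> r \<inter> leA_upset d \<alpha> \<Delta> r = {}"
    proof (rule ccontr)
      assume "\<not> ?thesis"
      then obtain x y b where xy: "x \<in> \<Gamma>" "y \<in> \<Delta>" "leA \<alpha> x b" "leA \<alpha> y b" by (auto simp: leA_upset_def)
      then have "eqmod \<alpha> x y" using leA_imp_eqmod eqmod_sym eqmod_trans by blast
      moreover have "y \<in> B\<^sub>A" using classD(1)[OF c(2)] xy by blast
      ultimately have "y \<in> \<Gamma>" using classD(3)[OF c(1) xy(1)] by blast
      moreover have "\<Gamma> \<inter> \<Delta> = {}"
        using quotient_disj[OF equiv_classes_rel c(1,2)[unfolded classes_eq]] c(3) by blast
      ultimately show False using xy(2) by blast
    qed
  qed
  ultimately show ?thesis by simp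
qed

lemma mult_degree_KB: "mult_degree d (K :: ('k::field mpoly, 'k mpoly) gmodule) = real (card Classes)"
proof -
  have "eventually_poly (d - 1) (1 / fact (d - 1)) (\<lambda>r. card (leA_upset d \<alpha> \<Gamma> r))" if "\<Gamma> \<in> Classes" for \<Gamma>
  proof (rule eventually_poly_upset)
    show "x \<in> nvecs d \<and> \<alpha> dvd total x" if "x \<in> \<Gamma>" for x
      using classD(1)[OF \<open>\<Gamma> \<in> Classes\<close>] that BA_in_B B_props by blast
    show "eqmod \<alpha> x y" if "x \<in> \<Gamma>" "y \<in> \<Gamma>" for x y
      using classD(3)[OF \<open>\<Gamma> \<in> Classes\<close>] that by blast
  qed (use classD[OF that] in auto)
  then have "eventually_poly (d - 1) (real (card Classes) * (1 / fact (d - 1)))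
      (\<lambda>r. \<Sum>\<Gamma>\<in>Classes. card (leA_upset d \<alpha> \<Gamma> r))"
    by (rule eventually_poly_sum[OF finite_classes])
  then obtain p r0 where p: "degree p \<le> d - 1" "Polynomial.coeff p (d - 1) = real (card Classes) * (1 / fact (d - 1))"
    "\<forall>r\<ge>r0. poly p (real r) = real (hilbert_fun (K :: ('k mpoly, 'k mpoly) gmodule) (int r))"
    unfolding eventually_poly_def card_B_deg[symmetric] hilbert_fun_KB by blast
  have "hilbert_poly (K :: ('k mpoly, 'k mpoly) gmodule) = p"
    unfolding hilbert_poly_def
  proof (rule the_equality)
    fix q :: "real poly"
    assume "\<exists>r0::nat. \<forall>r\<ge>r0. poly q (real r) = real (hilbert_fun (K :: ('k mpoly, 'k mpoly) gmodule) (int r))"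
    then show "q = p" using eventually_poly_unique[OF _ p(3)] by blast
  qed (use p(3) in blast)
  \<comment> \<open>Being nonzero, the coefficient at d - 1 is the leading one.\<close>
  moreover have "card Classes > 0"
    using finite_classes zero_in_BA by (auto simp: card_gt_0_iff classes_eq)
  then have "degree p = d - 1" using p(1,2) by (intro antisym le_degree) auto
  ultimately show ?thesis using p(2) by (simp add: mult_degree_def)
qed

end

theorem theorem3p2:
  fixes d \<alpha> c :: nat and a :: "nat \<Rightarrow> expo" and \<Gamma> :: "expo set"
  assumes "simplicial_data d \<alpha> c a"
    and "\<Gamma> \<in> GammaB TYPE('k::field) d \<alpha> c a"
    and "card \<Gamma> \<le> 2"
  shows "reg (d + c) (KB d \<alpha> c a :: ('k mpoly, 'k mpoly) gmodule)
    \<le> ereal (mult_degree d (KB d \<alpha> c a :: ('k mpoly, 'k mpoly) gmodule))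
       - codim (KB d \<alpha> c a :: ('k mpoly, 'k mpoly) gmodule)"
proof -
  interpret simplicial_semigroup d \<alpha> c a by unfold_locales (rule assms(1))
  have \<Gamma>: "\<Gamma> \<in> Classes"
    and reg: "reg (d + c) (K :: ('k mpoly, 'k mpoly) gmodule) =
      reg d (idealI d \<alpha> \<Gamma> :: ('k mpoly, 'k mpoly) gmodule) + ereal (vdeg \<alpha> (hvec d \<Gamma>))"
    using assms(2) by (auto simp: GammaB_def)
  obtain u v where uv: "u \<in> nvecs d" "v \<in> nvecs d"
    "(\<lambda>x. quot_vec d \<alpha> x (hvec d \<Gamma>)) ` \<Gamma> = {u, v}"
    "\<And>i. min (lookup u i) (lookup v i) = 0"
    and ineq: "real (total u + total v - 1) + vdeg \<alpha> (hvec d \<Gamma>) + real c \<le> real (card Classes)"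
    using class_inequality[OF \<Gamma> assms(3)] by blast
  have "reg d (idealI d \<alpha> \<Gamma> :: ('k mpoly, 'k mpoly) gmodule) \<le> ereal (real (total u + total v - 1))"
    unfolding idealI_eq uv(3) by (rule reg_two_generated_le[OF d_pos uv(1,2,4)])
  then have "reg (d + c) (K :: ('k mpoly, 'k mpoly) gmodule)
    \<le> ereal (real (total u + total v - 1)) + ereal (vdeg \<alpha> (hvec d \<Gamma>))"
    unfolding reg by (rule add_right_mono)
  also have "\<dots> \<le> ereal (real (card Classes)) - ereal (real c)"
    using ineq by simp
  also have "\<dots> \<le> ereal (mult_degree d (K :: ('k mpoly, 'k mpoly) gmodule)) - codim (K :: ('k mpoly, 'k mpoly) gmodule)"
    unfolding mult_degree_KB by (rule ereal_minus_mono[OF order_refl codim_KB_le])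
  finally show ?thesis .
qed

end
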